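(* Let $m_n$ denote the number of matroids with ground set $\{1,\ldots,n\}$ and let $s_n$ denote the number of sparse paving matroids with ground set $\{1,\ldots,n\}$. Then $$\log\log m_n \le \log\log s_n + 1 + o(1)\qquad\text{as } n\to\infty.$$
   Context: $\log$ denotes the logarithm to base 2. Matroids are counted as labelled objects on the fixed ground set $\{1,\ldots,n\}$, not up to isomorphism. For a matroid $M$, $r(M)$ denotes its rank and $M^*$ its dual. $M$ is paving if $|C|\ge r(M)$ for each circuit $C$ of $M$; $M$ is sparse if $M^*$ is paving; $M$ is sparse paving if it is both sparse and paving. The term $o(1)$ denotes a function of $n$ tending to $0$ as $n\to\infty$. *)

theory Defs
  imports Complex_Main "HOL-Library.Landau_Symbols"
begin

text \<open>
  A matroid is given by its finite ground set \<open>E\<close> and the family \<open>I\<close> of its independent sets.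
\<close>

definition matroid :: "'a set \<Rightarrow> 'a set set \<Rightarrow> bool" where
  "matroid E I \<longleftrightarrow>
     finite E \<and> I \<subseteq> Pow E \<and> {} \<in> I \<and>
     (\<forall>X\<in>I. \<forall>Y. Y \<subseteq> X \<longrightarrow> Y \<in> I) \<and>
     (\<forall>X\<in>I. \<forall>Y\<in>I. card X < card Y \<longrightarrow> (\<exists>y\<in>Y - X. insert y X \<in> I))"

definition bases :: "'a set set \<Rightarrow> 'a set set" where
  "bases I = {B \<in> I. \<forall>X\<in>I. B \<subseteq> X \<longrightarrow> X = B}"

definition circuits :: "'a set \<Rightarrow> 'a set set \<Rightarrow> 'a set set" where
  "circuits E I = {C. C \<subseteq> E \<and> C \<notin> I \<and> (\<forall>D. D \<subset> C \<longrightarrow> D \<in> I)}"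

definition matroid_rank :: "'a set set \<Rightarrow> nat" where
  "matroid_rank I = Max (card ` I)"

text \<open>
  Independent sets of the dual matroid on \<open>E\<close>, whose bases are the complements of the bases.
\<close>

definition dual :: "'a set \<Rightarrow> 'a set set \<Rightarrow> 'a set set" where
  "dual E I = {X. \<exists>B\<in>bases I. X \<subseteq> E - B}"

definition paving :: "'a set \<Rightarrow> 'a set set \<Rightarrow> bool" where
  "paving E I \<longleftrightarrow> (\<forall>C\<in>circuits E I. matroid_rank I \<le> card C)"

definition sparse :: "'a set \<Rightarrow> 'a set set \<Rightarrow> bool" where
  "sparse E I \<longleftrightarrow> paving E (dual E I)"

definition sparse_paving :: "'a set \<Rightarrow> 'a set set \<Rightarrow> bool" where
  "sparse_paving E I \<longleftrightarrow> sparse E I \<and> paving E I"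

definition num_matroids :: "nat \<Rightarrow> nat" where
  "num_matroids n = card {I. matroid {1..n} I}"

definition num_sparse_paving :: "nat \<Rightarrow> nat" where
  "num_sparse_paving n = card {I. matroid {1..n} I \<and> sparse_paving {1..n} I}"

end

theory Submission
  imports Defs "HOL-Analysis.Convex" "HOL-Real_Asymp.Real_Asymp"
begin

text \<open>
  Write \<open>N\<close> for the central binomial coefficient \<open>n choose (n div 2)\<close>. The number of sparse
  paving matroids is at least \<open>2 powr (N / n)\<close>, and the number of matroids is at most \<open>2 powr
  ((2 + o(1)) * N / n)\<close>. The ratio of the two exponents tends to 2, and its logarithm is the
  summand 1 of the theorem.

  Lower bound. Call two \<open>r\<close>-sets adjacent if they differ by one exchange; this is the Johnson
  graph. If no two members of a family \<open>S\<close> of \<open>r\<close>-sets are adjacent, then declaring exactly the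
  members of \<open>S\<close> to be nonbases gives a sparse paving matroid. Graham and Sloane found such a
  family with at least \<open>N / n\<close> members (\<open>stable_family_by_sums\<close>), and each of its subfamilies
  gives a different matroid (\<open>num_sparse_paving_ge\<close>).

  Upper bound. A matroid of rank \<open>r\<close> is determined by its nonbases, a set of vertices of the
  Johnson graph. The graph container method of Kleitman and Winston bounds the number of stable
  sets, and it survives in the following form. Let \<open>T(A)\<close> be the number of traces of nonbasis
  families on a vertex set \<open>A\<close>. If for every vertex \<open>v\<close> the nonbases adjacent to \<open>v\<close>, given that
  \<open>v\<close> is a nonbasis, can take at most \<open>L\<close> values, then \<open>T(A) \<le> T(A - {v}) + L * T(A - {v} - nbrs
  v)\<close> (\<open>card_traces_branch\<close>). A stable set has at most \<open>N / (n - r + 1)\<close> members, and every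
  larger set contains a vertex whose degree grows with the excess (\<open>johnson_supersaturation\<close>),
  so the second branch loses many vertices. Solving the recursion (\<open>card_traces_le\<close>) gives \<open>log
  T \<le> N / (n - r + 1) + O(N * log L * log n / n\<^sup>2)\<close> up to smaller terms. As \<open>r\<close> is close to \<open>n /
  2\<close>, the first term is \<open>(2 + o(1)) * N / n\<close>, and the second is negligible provided that \<open>log L
  = o(n / log n)\<close>.

  It remains to make \<open>L\<close> small. If a nonbasis \<open>v\<close> has rank less than \<open>r - 1\<close>, all its neighbours
  are nonbases. Otherwise the nonbases around \<open>v\<close> are described by the circuit inside \<open>v\<close> and the
  hyperplane spanned by \<open>v\<close> (\<open>exchange_nonbasis_iff\<close>), which in general costs about \<open>n\<close> bits,
  slightly too much. But only \<open>o(N / n)\<close> subsets have a size that differs from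
  \<open>n / 2\<close> by at least \<open>b = \<lceil>n powr (3/4)\<rceil>\<close> (\<open>card_large_sets_le\<close>), so the dependent sets and the
  nonspanning sets among them can be recorded beforehand. A small circuit or a large hyperplane
  then decides \<open>v\<close> in advance; for the undecided \<open>v\<close>, circuit and hyperplane differ from \<open>v\<close> in
  at most \<open>2 b\<close> elements each, and \<open>log L = O(b * log n)\<close> (\<open>card_local_traces_le\<close>).
\<close>

section \<open>Counting traces by branching\<close>

definition traces :: "'a set set \<Rightarrow> 'a set \<Rightarrow> 'a set set" where
  "traces \<K> A = (\<lambda>K. K \<inter> A) ` \<K>"

lemma traces_subset_Pow: "traces \<K> A \<subseteq> Pow A"
  by (auto simp: traces_def)

lemma finite_traces: "finite A \<Longrightarrow> finite (traces \<K> A)"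
  by (rule finite_subset[OF traces_subset_Pow]) simp

lemma card_traces_le_power: "finite A \<Longrightarrow> card (traces \<K> A) \<le> 2 ^ card A"
  by (metis card_Pow card_mono finite_Pow_iff traces_subset_Pow)

text \<open>
  Split on whether the member contains \<open>v\<close>. If it does not, its trace on \<open>A\<close> is a trace on \<open>A -
  {v}\<close>. If it does, the trace is recovered from its part in \<open>U\<close>, for which there are few
  possibilities, and its part outside \<open>U\<close>.
\<close>
lemma card_traces_branch:
  assumes "finite A" "v \<in> A" "finite U"
    and loc: "card (traces {K\<in>\<K>. v \<in> K} U) \<le> L"
  shows "card (traces \<K> A) \<le> card (traces \<K> (A - {v})) + L * card (traces \<K> (A - {v} - U))"
proof -
  let ?out = "traces {K\<in>\<K>. v \<notin> K} A" and ?in = "traces {K\<in>\<K>. v \<in> K} A"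
  let ?R = "A - {v} - U"
  have "?out = traces {K\<in>\<K>. v \<notin> K} (A - {v})"
    by (auto simp: traces_def)
  then have "?out \<subseteq> traces \<K> (A - {v})"
    by (auto simp: traces_def)
  then have out: "card ?out \<le> card (traces \<K> (A - {v}))"
    using assms(1) by (intro card_mono finite_traces) auto
  have "?in \<subseteq> (\<lambda>(P, Q). {v} \<union> (P \<inter> A) \<union> Q) ` (traces {K\<in>\<K>. v \<in> K} U \<times> traces \<K> ?R)"
  proof
    fix T assume "T \<in> ?in"
    then obtain K where K: "K \<in> \<K>" "v \<in> K" and T: "T = K \<inter> A"
      by (auto simp: traces_def)
    have "T = (\<lambda>(P, Q). {v} \<union> (P \<inter> A) \<union> Q) (K \<inter> U, K \<inter> ?R)"
      using K T assms(2) by auto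
    moreover have "(K \<inter> U, K \<inter> ?R) \<in> traces {K\<in>\<K>. v \<in> K} U \<times> traces \<K> ?R"
      using K by (auto simp: traces_def)
    ultimately show "T \<in> (\<lambda>(P, Q). {v} \<union> (P \<inter> A) \<union> Q) ` (traces {K\<in>\<K>. v \<in> K} U \<times> traces \<K> ?R)"
      by (rule image_eqI)
  qed
  then have "card ?in \<le> card (traces {K\<in>\<K>. v \<in> K} U \<times> traces \<K> ?R)"
    using assms(1,3) by (intro surj_card_le finite_cartesian_product finite_traces) auto
  also have "\<dots> \<le> L * card (traces \<K> ?R)"
    unfolding card_cartesian_product using loc by (rule mult_right_mono) simp
  finally have "card ?in \<le> L * card (traces \<K> ?R)" .
  moreover have "traces \<K> A = ?out \<union> ?in"
    by (auto simp: traces_def)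
  then have "card (traces \<K> A) \<le> card ?out + card ?in"
    by (metis card_Un_le)
  ultimately show ?thesis using out by linarith
qed

lemma exp_minus_le: "0 \<le> x \<Longrightarrow> x \<le> 1 \<Longrightarrow> exp (- x) \<le> 1 - x / 2" for x :: real
proof -
  assume x: "0 \<le> x" "x \<le> 1"
  have "(1 - x / 2) * (1 + x) \<ge> 1" using x by (simp add: algebra_simps) (metis mult_left_le power2_eq_square)
  moreover have "(1 - x / 2) * (1 + x) \<le> (1 - x / 2) * exp x"
    using x exp_ge_add_one_self by (intro mult_left_mono) auto
  ultimately show ?thesis by (simp add: exp_minus field_simps)
qed

text \<open>
  Iterating the branching bound along a vertex of large degree. When \<open>card A = t + s\<close>, the
  second branch loses at least \<open>D s / N\<close> points, so that \<open>s\<close> shrinks by the factor \<open>1 - D / N\<close>,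
  while the first branch replaces \<open>s\<close> by \<open>s - 1\<close>. A power \<open>s\<^sup>c\<close> with \<open>c = N k / D\<close> dominates
  both: \<open>(1 - 1 / s)\<^sup>c\<close> falls below 1 by at least \<open>k / (2 D)\<close>, and \<open>L (1 - D / N)\<^sup>c \<le> L exp (-
  k)\<close> fits into that gap. Once \<open>s \<le> u\<close>, the trivial bound \<open>2 powr card A\<close> takes over. A jump
  from above \<open>u\<close> can land below \<open>u\<close>, but not below \<open>u / 2\<close> in the bound \<open>s (1 - D / N)\<close>, which
  is why the power is normalised at \<open>u / 2\<close>.
\<close>
lemma card_traces_le:
  fixes N D k t u :: real and nbr :: "'a \<Rightarrow> 'a set"
  assumes V: "finite V" "real (card V) \<le> N"
    and loc: "\<And>v. v \<in> V \<Longrightarrow> finite (nbr v) \<and> v \<notin> nbr v \<and> card (traces {K\<in>\<K>. v \<in> K} (nbr v)) \<le> L"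
    and dense: "\<And>A. A \<subseteq> V \<Longrightarrow> A \<noteq> {} \<Longrightarrow> \<exists>v\<in>A. D / N * (real (card A) - t) \<le> real (card (nbr v \<inter> A))"
    and D: "0 < D" "2 * D \<le> N"
    and k: "0 \<le> k" "k \<le> D" "real L * exp (- k) \<le> k / (2 * D)"
    and tu: "0 \<le> t" "2 \<le> u"
  shows "A \<subseteq> V \<Longrightarrow> real (card (traces \<K> A)) \<le>
           2 powr (t + u) * (max (real (card A) - t) (u / 2) / (u / 2)) powr (N * k / D)"
proof (induction "card A" arbitrary: A rule: less_induct)
  case less
  define c where "c = N * k / D"
  define g where "g x = 2 powr (t + u) * (x / (u / 2)) powr c" for x
  define s where "s = real (card A) - t"
  have N: "N > 0" and c: "c \<ge> 0" using D k by (auto simp: c_def)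
  have finA: "finite A" using less.prems V finite_subset by blast
  have g_mono: "g x \<le> g y" if "0 \<le> x" "x \<le> y" for x y
    unfolding g_def using that tu c by (intro mult_left_mono powr_mono2 divide_right_mono) auto
  have IH: "real (card (traces \<K> B)) \<le> g x"
    if "B \<subset> A" "real (card B) - t \<le> x" "u / 2 \<le> x" for B x
  proof -
    have "card B < card A" using that finA psubset_card_mono by blast
    then have "real (card (traces \<K> B)) \<le> g (max (real (card B) - t) (u / 2))"
      unfolding g_def c_def using that less.prems by (intro less.hyps) auto
    also have "\<dots> \<le> g x" using that tu by (intro g_mono) auto
    finally show ?thesis .
  qed
  have "real (card (traces \<K> A)) \<le> g (max s (u / 2))"
  proof (cases "s \<le> u")
    case True
    have "real (card (traces \<K> A)) \<le> real (2 ^ card A)"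
      using card_traces_le_power[OF finA] by (simp only: of_nat_le_iff)
    also have "\<dots> = 2 powr (real (card A))" by (simp add: powr_realpow)
    also have "\<dots> \<le> 2 powr (t + u)" using True by (simp add: s_def)
    also have "\<dots> = g (u / 2)" using tu by (simp add: g_def)
    also have "\<dots> \<le> g (max s (u / 2))" using tu by (intro g_mono) auto
    finally show ?thesis .
  next
    case False
    then have "A \<noteq> {}" using tu by (auto simp: s_def)
    then obtain v where v: "v \<in> A" and deg: "D / N * s \<le> real (card (nbr v \<inter> A))"
      using dense[OF less.prems] unfolding s_def by blast
    have vV: "v \<in> V" using v less.prems by auto
    have DN: "0 < D / N" "D / N \<le> 1 / 2" using D N by (auto simp: field_simps)
    have s: "s > u" "s \<le> N" "s > 0"
      using False tu V less.prems card_mono[OF V(1) less.prems] by (auto simp: s_def)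
    have "real (card (traces \<K> A)) \<le> real (card (traces \<K> (A - {v})))
        + real L * real (card (traces \<K> (A - {v} - nbr v)))"
      using card_traces_branch[OF finA v, of "nbr v" \<K> L] loc[OF vV]
      by (metis of_nat_add of_nat_le_iff of_nat_mult)
    also have "\<dots> \<le> g (s - 1) + real L * g (s * (1 - D / N))"
    proof (intro add_mono mult_left_mono)
      show "real (card (traces \<K> (A - {v}))) \<le> g (s - 1)"
        using v finA s tu card_gt_0_iff[of A]
        by (intro IH) (auto simp: s_def card_Diff_singleton of_nat_diff)
      show "real (card (traces \<K> (A - {v} - nbr v))) \<le> g (s * (1 - D / N))"
      proof (intro IH)
        have "card (A - {v} - nbr v) \<le> card (A - nbr v)"
          using finA by (intro card_mono) auto
        moreover have "real (card (A - nbr v)) = real (card A) - real (card (nbr v \<inter> A))"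
          using finA by (metis Int_commute card_Diff_subset_Int card_mono finite_Int inf_le1 of_nat_diff)
        ultimately show "real (card (A - {v} - nbr v)) - t \<le> s * (1 - D / N)"
          using deg by (simp add: s_def algebra_simps)
        have "u / 2 \<le> s * (1 / 2)" using s by simp
        also have "\<dots> \<le> s * (1 - D / N)" using s DN by (intro mult_left_mono) auto
        finally show "u / 2 \<le> s * (1 - D / N)" .
      qed (use v in auto)
    qed auto
    also have "g (s - 1) = g s * (1 - 1 / s) powr c"
    proof -
      have "(s - 1) / (u / 2) = s / (u / 2) * (1 - 1 / s)" using s by (simp add: right_diff_distrib diff_divide_distrib)
      then show ?thesis using s tu unfolding g_def by (simp only: powr_mult mult.assoc)
    qed
    also have "g (s * (1 - D / N)) = g s * (1 - D / N) powr c"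
    proof -
      have "s * (1 - D / N) / (u / 2) = s / (u / 2) * (1 - D / N)" by simp
      then show ?thesis using s tu DN unfolding g_def by (simp only: powr_mult mult.assoc)
    qed
    also have "g s * (1 - 1 / s) powr c + real L * (g s * (1 - D / N) powr c)
        = g s * ((1 - 1 / s) powr c + real L * (1 - D / N) powr c)"
      by (simp add: algebra_simps)
    also have "\<dots> \<le> g s * 1"
    proof (rule mult_left_mono)
      have pw: "(1 - x) powr c \<le> exp (- (c * x))" if "x < 1" for x :: real
      proof -
        have "ln (1 - x) \<le> - x" using that ln_le_minus_one[of "1 - x"] by simp
        then show ?thesis using that c by (simp add: powr_def mult_left_mono mult_minus_right[symmetric] del: mult_minus_right)
      qed
      have "(1 - 1 / s) powr c \<le> exp (- (c * (1 / s)))" using s tu by (intro pw) auto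
      also have "\<dots> \<le> exp (- (k / D))"
      proof -
        have "k / D = c * (1 / N)" using N by (simp add: c_def)
        also have "\<dots> \<le> c * (1 / s)" using s c by (intro mult_left_mono divide_left_mono) auto
        finally show ?thesis by simp
      qed
      also have "\<dots> \<le> 1 - k / D / 2" using k D by (intro exp_minus_le) auto
      finally have 1: "(1 - 1 / s) powr c \<le> 1 - k / (2 * D)" by simp
      have "c * (D / N) = k" using N D by (simp add: c_def)
      then have "(1 - D / N) powr c \<le> exp (- k)" using pw[of "D / N"] DN by simp
      then have "real L * (1 - D / N) powr c \<le> real L * exp (- k)" by (intro mult_left_mono) auto
      then show "(1 - 1 / s) powr c + real L * (1 - D / N) powr c \<le> 1" using 1 k(3) by linarith
    qed (simp add: g_def)
    also have "\<dots> \<le> g (max s (u / 2))" using s tu by (simp add: max_def)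
    finally show ?thesis .
  qed
  then show ?case by (simp add: g_def c_def s_def)
qed

section \<open>Degrees in the Johnson graph\<close>

definition slice :: "'a set \<Rightarrow> nat \<Rightarrow> 'a set set" where
  "slice E r = {X. X \<subseteq> E \<and> card X = r}"

definition johnson_nbrs :: "'a set \<Rightarrow> 'a set \<Rightarrow> 'a set set" where
  "johnson_nbrs E X = {Y. Y \<subseteq> E \<and> card Y = card X \<and> Suc (card (X \<inter> Y)) = card X}"

lemma finite_slice: "finite E \<Longrightarrow> finite (slice E r)"
  unfolding slice_def by (rule finite_subset[of _ "Pow E"]) auto

lemma card_slice: "finite E \<Longrightarrow> card (slice E r) = card E choose r"
  by (simp add: slice_def n_subsets)

lemma finite_johnson_nbrs: "finite E \<Longrightarrow> finite (johnson_nbrs E X)"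
  unfolding johnson_nbrs_def by (rule finite_subset[of _ "Pow E"]) auto

lemma johnson_nbrs_irrefl: "X \<notin> johnson_nbrs E X"
  by (simp add: johnson_nbrs_def)

text \<open>
  The adjacency matrix of the Johnson graph plus \<open>r\<close> times the identity counts common subsets of
  size \<open>r - 1\<close>. Hence the sum of \<open>degree + r\<close> over \<open>A\<close> is at least the sum of the squares of the
  numbers \<open>d T\<close> of members of \<open>A\<close> above an \<open>(r - 1)\<close>-set \<open>T\<close>. The numbers \<open>d T\<close> add up to \<open>r *
  card A\<close>, so the Cauchy-Schwarz inequality gives a lower bound for the average degree, which
  some member of \<open>A\<close> attains. In particular a stable set has at most \<open>N / m\<close> members; beyond
  this threshold degrees grow linearly.
\<close>
lemma johnson_supersaturation:
  fixes E :: "'a set"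
  assumes E: "finite E" and r: "1 \<le> r" "r \<le> card E"
    and A: "A \<subseteq> slice E r" "A \<noteq> {}"
  defines "N \<equiv> real (card E choose r)" and "m \<equiv> real (card E - r + 1)"
  shows "\<exists>X\<in>A. real r * m / N * (real (card A) - N / m) \<le> real (card (johnson_nbrs E X \<inter> A))"
proof -
  define S where "S = slice E (r - 1)"
  define d where "d T = card {X \<in> A. T \<subseteq> X}" for T
  have finA: "finite A" using A(1) finite_slice[OF E] finite_subset by blast
  have finS: "finite S" using finite_slice[OF E] by (simp add: S_def)
  have inA: "X \<subseteq> E" "card X = r" "finite X" if "X \<in> A" for X
    using A(1) that finite_subset[OF _ E] by (auto simp: slice_def)
  have below: "card {T\<in>S. T \<subseteq> Z} = card Z choose (r - 1)" if "Z \<subseteq> E" for Z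
  proof -
    have "{T\<in>S. T \<subseteq> Z} = {T. T \<subseteq> Z \<and> card T = r - 1}"
      using that by (auto simp: S_def slice_def)
    then show ?thesis using that E finite_subset n_subsets by metis
  qed
  have Nm: "N > 0" "m > 0" using r by (auto simp: N_def m_def)
  have sumd: "(\<Sum>T\<in>S. d T) = r * card A"
  proof -
    have "(\<Sum>T\<in>S. d T) = (\<Sum>T\<in>S. \<Sum>X\<in>A. if T \<subseteq> X then 1 else 0)"
      using finA by (simp add: d_def sum.If_cases Int_def)
    also have "\<dots> = (\<Sum>X\<in>A. \<Sum>T\<in>S. if T \<subseteq> X then 1 else 0)" by (rule sum.swap)
    also have "\<dots> = (\<Sum>X\<in>A. card X choose (r - 1))"
      using finS inA by (intro sum.cong) (auto simp: sum.If_cases Int_def below)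
    also have "\<dots> = (\<Sum>X\<in>A. r)"
      using inA r binomial_symmetric[of "r - 1" r] by (intro sum.cong) auto
    finally show ?thesis by simp
  qed
  have sumd2: "(\<Sum>T\<in>S. (d T)\<^sup>2) \<le> (\<Sum>X\<in>A. card (johnson_nbrs E X \<inter> A) + r)"
  proof -
    have "(\<Sum>T\<in>S. (d T)\<^sup>2) = (\<Sum>T\<in>S. \<Sum>X\<in>A. \<Sum>Y\<in>A. if T \<subseteq> X \<inter> Y then 1 else 0)"
    proof (rule sum.cong[OF refl])
      fix T
      have "d T = (\<Sum>X\<in>A. if T \<subseteq> X then 1 else 0)"
        using finA by (simp add: d_def sum.If_cases Int_def)
      then have "(d T)\<^sup>2 = (\<Sum>X\<in>A. \<Sum>Y\<in>A. (if T \<subseteq> X then 1 else 0) * (if T \<subseteq> Y then 1 else 0))"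
        by (simp add: power2_eq_square sum_product)
      also have "\<dots> = (\<Sum>X\<in>A. \<Sum>Y\<in>A. if T \<subseteq> X \<inter> Y then 1 else 0)"
        by (intro sum.cong) auto
      finally show "(d T)\<^sup>2 = \<dots>" .
    qed
    also have "\<dots> = (\<Sum>X\<in>A. \<Sum>T\<in>S. \<Sum>Y\<in>A. if T \<subseteq> X \<inter> Y then 1 else 0)" by (rule sum.swap)
    also have "\<dots> = (\<Sum>X\<in>A. \<Sum>Y\<in>A. \<Sum>T\<in>S. if T \<subseteq> X \<inter> Y then 1 else 0)"
      by (intro sum.cong[OF refl] sum.swap)
    also have "\<dots> = (\<Sum>X\<in>A. \<Sum>Y\<in>A. card (X \<inter> Y) choose (r - 1))"
    proof (intro sum.cong refl)
      fix X Y assume "X \<in> A" "Y \<in> A"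
      then have "card {T\<in>S. T \<subseteq> X \<inter> Y} = card (X \<inter> Y) choose (r - 1)"
        using inA by (intro below) auto
      then show "(\<Sum>T\<in>S. if T \<subseteq> X \<inter> Y then 1 else 0) = card (X \<inter> Y) choose (r - 1)"
        using finS by (simp add: sum.If_cases Int_def)
    qed
    also have "\<dots> \<le> (\<Sum>X\<in>A. \<Sum>Y\<in>A. (if Y \<in> johnson_nbrs E X then 1 else 0) + (if Y = X then r else 0))"
    proof (intro sum_mono)
      fix X Y assume XY: "X \<in> A" "Y \<in> A"
      have le: "card (X \<inter> Y) \<le> r" using inA XY by (metis card_mono inf_le1)
      consider "card (X \<inter> Y) = r" | "card (X \<inter> Y) = r - 1" | "card (X \<inter> Y) < r - 1"
        using le r by linarith
      then show "card (X \<inter> Y) choose (r - 1)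
          \<le> (if Y \<in> johnson_nbrs E X then 1 else 0) + (if Y = X then r else 0)"
      proof cases
        case 1
        then have "X \<inter> Y = X" "X \<inter> Y = Y"
          using inA XY card_subset_eq by (metis inf_le1, metis inf_le2)
        then show ?thesis using 1 r binomial_symmetric[of "r - 1" r] inA XY by auto
      next
        case 2
        then have "Y \<in> johnson_nbrs E X"
          using inA XY r by (auto simp: johnson_nbrs_def)
        then show ?thesis using 2 by simp
      next
        case 3
        then show ?thesis by (simp add: binomial_eq_0)
      qed
    qed
    also have "\<dots> = (\<Sum>X\<in>A. card (johnson_nbrs E X \<inter> A) + r)"
      using finA by (intro sum.cong) (auto simp: sum.distrib sum.If_cases Int_def conj_commute)
    finally show ?thesis .
  qed
  have cardS: "real (card S) * m = real r * N"
  proof -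
    have "(card E choose (r - 1)) * (card E - r + 1) = r * (card E choose r)"
      using binomial_absorb_comp[of "card E" "r - 1"] binomial_absorption[of "r - 1" "card E"] r
      by (cases r) (auto simp: algebra_simps Suc_diff_Suc binomial_absorption binomial_absorb_comp simp del: binomial_Suc_Suc)
    then have "real (card S * (card E - r + 1)) = real (r * (card E choose r))"
      by (simp only: S_def card_slice[OF E])
    then show ?thesis unfolding N_def m_def by (simp only: of_nat_mult)
  qed
  have "(real r * real (card A))\<^sup>2 = (\<Sum>T\<in>S. real (d T))\<^sup>2"
    by (metis sumd of_nat_mult of_nat_sum)
  also have "\<dots> \<le> (\<Sum>T\<in>S. (real (d T))\<^sup>2) * real (card S)"
    by (rule sum_squared_le_sum_of_squares)
  also have "(\<Sum>T\<in>S. (real (d T))\<^sup>2) \<le> (\<Sum>X\<in>A. real (card (johnson_nbrs E X \<inter> A)) + real r)"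
  proof -
    have "real (\<Sum>T\<in>S. (d T)\<^sup>2) \<le> real (\<Sum>X\<in>A. card (johnson_nbrs E X \<inter> A) + r)"
      using sumd2 by (simp only: of_nat_le_iff)
    then show ?thesis by simp
  qed
  finally have main: "(real r * real (card A))\<^sup>2
      \<le> (\<Sum>X\<in>A. real (card (johnson_nbrs E X \<inter> A)) + real r) * real (card S)"
    by (simp add: mult_right_mono)
  show ?thesis
  proof (rule ccontr)
    assume neg: "\<not> ?thesis"
    have a: "real (card A) > 0" using finA A(2) by (simp add: card_gt_0_iff)
    have "(\<Sum>X\<in>A. real (card (johnson_nbrs E X \<inter> A)) + real r)
        < (\<Sum>X\<in>A. real r * m / N * real (card A))"
    proof (rule sum_strict_mono[OF finA A(2)])
      fix X assume "X \<in> A"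
      then have "real (card (johnson_nbrs E X \<inter> A)) < real r * m / N * (real (card A) - N / m)"
        using neg by force
      also have "\<dots> = real r * m / N * real (card A) - real r"
        using Nm by (simp add: right_diff_distrib)
      finally show "real (card (johnson_nbrs E X \<inter> A)) + real r < real r * m / N * real (card A)"
        by simp
    qed
    also have "\<dots> = real r * m / N * (real (card A))\<^sup>2" by (simp add: power2_eq_square)
    finally have "(\<Sum>X\<in>A. real (card (johnson_nbrs E X \<inter> A)) + real r) * real (card S)
        < real r * m / N * (real (card A))\<^sup>2 * real (card S)"
      using cardS Nm r by (intro mult_strict_right_mono) (auto intro!: Nat.gr0I)
    also have "\<dots> = real r * (real (card A))\<^sup>2 / N * (real (card S) * m)" by simp
    also have "\<dots> = (real r * real (card A))\<^sup>2"
      unfolding cardS using Nm by (simp add: power2_eq_square)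
    finally show False using main by simp
  qed
qed

section \<open>Nonbases around a nonbasis\<close>

lemma matroid_finite: "matroid E I \<Longrightarrow> finite I"
  unfolding matroid_def by (meson finite_Pow_iff finite_subset)

lemma matroid_indep_finite: "matroid E I \<Longrightarrow> X \<in> I \<Longrightarrow> finite X"
  unfolding matroid_def by (meson PowD finite_subset subsetD)

lemma matroid_subset: "matroid E I \<Longrightarrow> X \<in> I \<Longrightarrow> Y \<subseteq> X \<Longrightarrow> Y \<in> I"
  unfolding matroid_def by blast

lemma matroid_augment:
  "matroid E I \<Longrightarrow> X \<in> I \<Longrightarrow> Y \<in> I \<Longrightarrow> card X < card Y \<Longrightarrow> \<exists>y\<in>Y - X. insert y X \<in> I"
  unfolding matroid_def by blast

lemma card_le_matroid_rank: "matroid E I \<Longrightarrow> X \<in> I \<Longrightarrow> card X \<le> matroid_rank I"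
  unfolding matroid_rank_def using matroid_finite by (intro Max_ge) auto

lemma matroid_rank_attained: "matroid E I \<Longrightarrow> \<exists>B\<in>I. card B = matroid_rank I"
proof -
  assume M: "matroid E I"
  then have "I \<noteq> {}" by (auto simp: matroid_def)
  then have "Max (card ` I) \<in> card ` I" using matroid_finite[OF M] by (intro Max_in) auto
  then show ?thesis by (auto simp: matroid_rank_def)
qed

text \<open>
  Repeated augmentation enlarges \<open>X\<close> to the size of \<open>Y\<close>, using elements of \<open>Y\<close> only.
\<close>
lemma matroid_extend:
  assumes M: "matroid E I" and X: "X \<in> I" and Y: "Y \<in> I" and c: "card X \<le> card Y"
  shows "\<exists>Z\<in>I. X \<subseteq> Z \<and> Z \<subseteq> X \<union> Y \<and> card Z = card Y"
  using X c
proof (induction "card Y - card X" arbitrary: X)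
  case 0
  then show ?case by (intro bexI[of _ X]) auto
next
  case (Suc j)
  then have "card X < card Y" by simp
  then obtain y where y: "y \<in> Y - X" "insert y X \<in> I"
    using matroid_augment[OF M Suc.prems(1) Y] by blast
  have "card (insert y X) = Suc (card X)"
    using y matroid_indep_finite[OF M Suc.prems(1)] by simp
  then have "j = card Y - card (insert y X)" "card (insert y X) \<le> card Y"
    using Suc.hyps(2) \<open>card X < card Y\<close> by linarith+
  then obtain Z where "Z \<in> I" "insert y X \<subseteq> Z" "Z \<subseteq> insert y X \<union> Y" "card Z = card Y"
    using Suc.hyps(1) y(2) by blast
  then show ?case using y by (intro bexI[of _ Z]) auto
qed

definition nonbases :: "'a set \<Rightarrow> nat \<Rightarrow> 'a set set \<Rightarrow> 'a set set" where
  "nonbases E r I = slice E r - I"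

definition spanning :: "nat \<Rightarrow> 'a set set \<Rightarrow> 'a set \<Rightarrow> bool" where
  "spanning r I W \<longleftrightarrow> (\<exists>B\<in>I. card B = r \<and> B \<subseteq> W)"

text \<open>
  A matroid of known rank is the downward closure of its bases.
\<close>
lemma matroid_eq_of_nonbases:
  assumes "matroid E I" "matroid_rank I = r" "matroid E J" "matroid_rank J = r"
    and "nonbases E r I = nonbases E r J"
  shows "I = J"
proof -
  have "I \<subseteq> J" if IJ: "matroid E I" "matroid_rank I = r" "matroid E J"
    "nonbases E r I = nonbases E r J" for I J
  proof
    fix X assume X: "X \<in> I"
    obtain B where B: "B \<in> I" "card B = r" using matroid_rank_attained[OF IJ(1)] IJ(2) by auto
    then obtain Z where Z: "Z \<in> I" "X \<subseteq> Z" "card Z = r"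
      using matroid_extend[OF IJ(1) X B(1)] card_le_matroid_rank[OF IJ(1) X] IJ(2) by auto
    then have "Z \<in> J"
      using IJ by (auto simp: nonbases_def slice_def matroid_def)
    then show "X \<in> J" using Z IJ matroid_subset by blast
  qed
  then show ?thesis using assms by (intro equalityI) simp_all
qed

text \<open>
  Let \<open>X\<close> be a nonbasis of size \<open>r\<close>. The nonbases among the exchanges \<open>X - x + y\<close> are governed
  by two sets: the set of those \<open>x\<close> for which \<open>X - x\<close> is independent, and the set of those \<open>y\<close>
  for which \<open>X + y\<close> does not span. If the first set is not empty, \<open>X\<close> has rank \<open>r - 1\<close>, the
  first set is the unique circuit in \<open>X\<close>, and the second, together with \<open>X\<close>, is the hyperplane
  spanned by \<open>X\<close>. The circuit is dependent and the hyperplane does not span, so once all small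
  dependent sets and all large nonspanning sets are on record, an unrecorded circuit is large,
  an unrecorded hyperplane is small, and both are close to \<open>X\<close>.
\<close>
context
  fixes E :: "'a set" and I :: "'a set set" and r :: nat and X :: "'a set"
  assumes M: "matroid E I" and rk: "matroid_rank I = r"
    and X: "X \<in> nonbases E r I"
begin

private lemma X': "X \<subseteq> E" "card X = r" "finite X" "X \<notin> I"
  using X M finite_subset by (auto simp: nonbases_def slice_def matroid_def)

lemma exchange_nonbasis_iff:
  assumes x: "x \<in> X" and y: "y \<in> E - X"
  shows "insert y (X - {x}) \<in> nonbases E r I \<longleftrightarrow> X - {x} \<notin> I \<or> \<not> spanning r I (insert y X)"
proof -
  let ?Y = "insert y (X - {x})"
  have cY: "card ?Y = r" using x y X' card_Suc_Diff1[of X x] by simp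
  have "?Y \<in> I \<longleftrightarrow> X - {x} \<in> I \<and> spanning r I (insert y X)"
  proof
    assume "?Y \<in> I"
    then show "X - {x} \<in> I \<and> spanning r I (insert y X)"
      using matroid_subset[OF M, of ?Y "X - {x}"] cY unfolding spanning_def by blast
  next
    assume *: "X - {x} \<in> I \<and> spanning r I (insert y X)"
    then obtain B where B: "B \<in> I" "card B = r" "B \<subseteq> insert y X" by (auto simp: spanning_def)
    have "card (X - {x}) < card B" using x X' B by (metis card_Diff1_less)
    then obtain z where z: "z \<in> B - (X - {x})" "insert z (X - {x}) \<in> I"
      using matroid_augment[OF M _ B(1)] * by blast
    have "z \<noteq> x" using z(2) X' x by (metis insert_Diff)
    then show "?Y \<in> I" using z B by auto
  qed
  moreover have "?Y \<in> slice E r" using x y X' cY by (auto simp: slice_def)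
  ultimately show ?thesis by (auto simp: nonbases_def)
qed

text \<open>
  Were \<open>C = {x\<in>X. X - {x} \<in> I}\<close> independent, it would extend inside \<open>X\<close> to an independent \<open>X -
  {z}\<close> with \<open>z \<notin> C\<close>, contrary to the definition of \<open>C\<close>.
\<close>
lemma circuit_of_nonbasis:
  assumes "{x\<in>X. X - {x} \<in> I} \<noteq> {}"
  shows "{x\<in>X. X - {x} \<in> I} \<notin> I"
proof
  let ?C = "{x\<in>X. X - {x} \<in> I}"
  assume C: "?C \<in> I"
  obtain a where a: "a \<in> X" "X - {a} \<in> I" using assms by blast
  have "?C \<noteq> X" using C X' by auto
  then have "?C \<subset> X" by blast
  then have "card ?C < card X" using X' psubset_card_mono by blast
  then have "card ?C \<le> card (X - {a})" using a X' by simp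
  then obtain Z where Z: "Z \<in> I" "?C \<subseteq> Z" "Z \<subseteq> ?C \<union> (X - {a})" "card Z = card (X - {a})"
    using matroid_extend[OF M C a(2)] by blast
  have "Z \<subseteq> X" using Z(3) by auto
  have "card (X - Z) = card X - card Z"
    using \<open>Z \<subseteq> X\<close> X' finite_subset by (metis card_Diff_subset)
  also have "\<dots> = 1" using Z(4) a X' card_gt_0_iff[of X] by (auto simp: card_Diff_singleton)
  finally have "card (X - Z) = 1" .
  then obtain z where z: "X - Z = {z}" using card_1_singletonE by blast
  then have "X - {z} = Z" using \<open>Z \<subseteq> X\<close> by blast
  then have "z \<in> ?C" using z Z(1) by auto
  then show False using z Z(2) by blast
qed

text \<open>
  A basis inside this set would augment some independent \<open>X - {a}\<close> by an element \<open>z\<close> outside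
  \<open>X\<close>, and \<open>z\<close> would then make \<open>insert z X\<close> spanning.
\<close>
lemma hyperplane_of_nonbasis:
  assumes "{x\<in>X. X - {x} \<in> I} \<noteq> {}"
  shows "\<not> spanning r I (X \<union> {y\<in>E - X. \<not> spanning r I (insert y X)})"
proof
  assume "spanning r I (X \<union> {y\<in>E - X. \<not> spanning r I (insert y X)})"
  then obtain B where B: "B \<in> I" "card B = r"
    "B \<subseteq> X \<union> {y\<in>E - X. \<not> spanning r I (insert y X)}" by (auto simp: spanning_def)
  obtain a where a: "a \<in> X" "X - {a} \<in> I" using assms by blast
  have "card (X - {a}) < card B" using a X' B by (metis card_Diff1_less)
  then obtain z where z: "z \<in> B - (X - {a})" "insert z (X - {a}) \<in> I"
    using matroid_augment[OF M a(2) B(1)] by blast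
  have "z \<noteq> a" using z(2) X' a by (metis insert_Diff)
  then have "z \<notin> X" using z by blast
  then have ns: "\<not> spanning r I (insert z X)" using z B(3) by blast
  have "card (insert z (X - {a})) = r" using \<open>z \<notin> X\<close> a X' card_Suc_Diff1[of X a] by simp
  then show False using ns z(2) unfolding spanning_def by blast
qed

end

lemma johnson_nbrs_eq_exchanges:
  assumes "finite E" "X \<subseteq> E"
  shows "johnson_nbrs E X = (\<lambda>(x, y). insert y (X - {x})) ` (X \<times> (E - X))"
proof (intro equalityI subsetI)
  fix Y assume Y: "Y \<in> johnson_nbrs E X"
  have fin: "finite X" "finite Y" using assms Y finite_subset by (auto simp: johnson_nbrs_def)
  have "card (X - Y) = 1" "card (Y - X) = 1"
    using Y fin card_Diff_subset_Int[of X Y] card_Diff_subset_Int[of Y X]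
    by (auto simp: johnson_nbrs_def Int_commute)
  then obtain x y where xy: "X - Y = {x}" "Y - X = {y}" by (meson card_1_singletonE)
  then have "Y = insert y (X - {x})" "x \<in> X" "y \<in> E - X"
    using Y by (auto simp: johnson_nbrs_def)
  then show "Y \<in> (\<lambda>(x, y). insert y (X - {x})) ` (X \<times> (E - X))" by force
next
  fix Y assume "Y \<in> (\<lambda>(x, y). insert y (X - {x})) ` (X \<times> (E - X))"
  then obtain x y where xy: "x \<in> X" "y \<in> E - X" "Y = insert y (X - {x})" by auto
  have "finite X" using assms finite_subset by blast
  moreover have "X \<inter> Y = X - {x}" using xy by auto
  ultimately show "Y \<in> johnson_nbrs E X"
    using xy assms card_Suc_Diff1[of X x] by (auto simp: johnson_nbrs_def)
qed

text \<open>
  A set of at most \<open>k\<close> elements is listed by a word of length \<open>k\<close> over \<open>E\<close> with one extra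
  padding letter.
\<close>
lemma card_small_subsets_le:
  assumes "finite E"
  shows "card {W. W \<subseteq> E \<and> card W \<le> k} \<le> (card E + 1) ^ k"
proof -
  define f :: "'a option list \<Rightarrow> 'a set" where "f xs = set (map the (filter (\<lambda>z. z \<noteq> None) xs))" for xs
  let ?L = "{xs. set xs \<subseteq> insert None (Some ` E) \<and> length xs = k}"
  have fin: "finite ?L" using assms by (intro finite_lists_length_eq) auto
  have "{W. W \<subseteq> E \<and> card W \<le> k} \<subseteq> f ` ?L"
  proof
    fix W assume "W \<in> {W. W \<subseteq> E \<and> card W \<le> k}"
    then have W: "W \<subseteq> E" "card W \<le> k" by auto
    then obtain ws where ws: "set ws = W" "length ws = card W"
      using assms finite_subset by (metis finite_distinct_list distinct_card)
    let ?xs = "map Some ws @ replicate (k - card W) None"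
    have "?xs \<in> ?L" using W ws by (auto simp: set_replicate_conv_if)
    moreover have "W = f ?xs" using ws by (auto simp: f_def filter_map o_def)
    ultimately show "W \<in> f ` ?L" by (rule image_eqI[rotated])
  qed
  then have "card {W. W \<subseteq> E \<and> card W \<le> k} \<le> card ?L" by (rule surj_card_le[OF fin])
  also have "\<dots> = (card E + 1) ^ k"
    using assms by (subst card_lists_length_eq) (auto simp: card_image card_insert_if)
  finally show ?thesis .
qed

section \<open>Matroids with a given record of far sets\<close>

definition small_sets :: "'a set \<Rightarrow> nat \<Rightarrow> 'a set set" where
  "small_sets E b = {W. W \<subseteq> E \<and> 2 * card W + 2 * b \<le> card E}"

definition large_sets :: "'a set \<Rightarrow> nat \<Rightarrow> 'a set set" where
  "large_sets E b = {W. W \<subseteq> E \<and> card E + 2 * b \<le> 2 * card W}"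

text \<open>
  The sets whose size is far from half of the ground set are so few that everything about them
  can be written down: which of the small ones are dependent and which of the large ones fail to
  span.
\<close>
definition far_record :: "'a set \<Rightarrow> nat \<Rightarrow> nat \<Rightarrow> 'a set set \<Rightarrow> 'a set set \<times> 'a set set" where
  "far_record E b r I =
     ({W \<in> small_sets E b. W \<notin> I}, {W \<in> large_sets E b. \<not> spanning r I W})"

text \<open>
  The \<open>r\<close>-sets that a record \<open>R\<close> does not force to be nonbases.
\<close>
definition undecided :: "'a set \<Rightarrow> nat \<Rightarrow> 'a set set \<times> 'a set set \<Rightarrow> 'a set set" where
  "undecided E r R = {X \<in> slice E r. (\<forall>W\<in>fst R. \<not> W \<subseteq> X) \<and> (\<forall>W\<in>snd R. \<not> X \<subseteq> W)}"

lemma nonbasis_if_decided: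
  assumes "matroid E I" "X \<in> slice E r" "X \<notin> undecided E r (far_record E b r I)"
  shows "X \<in> nonbases E r I"
  using assms matroid_subset[OF assms(1)]
  by (auto simp: undecided_def far_record_def nonbases_def spanning_def slice_def)

definition recorded_matroids :: "'a set \<Rightarrow> nat \<Rightarrow> nat \<Rightarrow> 'a set set \<times> 'a set set \<Rightarrow> 'a set set set" where
  "recorded_matroids E b r R = {I. matroid E I \<and> matroid_rank I = r \<and> far_record E b r I = R}"

lemma finite_matroids: "finite E \<Longrightarrow> finite {I. matroid E I \<and> P I}"
  by (rule finite_subset[of _ "Pow (Pow E)"]) (auto simp: matroid_def)

lemma card_recorded_matroids_le:
  assumes E: "finite E"
  shows "card (recorded_matroids E b r R)
    \<le> card (traces (nonbases E r ` recorded_matroids E b r R) (undecided E r R))"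
proof -
  let ?M = "recorded_matroids E b r R" and ?f = "\<lambda>I. nonbases E r I \<inter> undecided E r R"
  have "inj_on ?f ?M"
  proof
    fix I J assume IJ: "I \<in> ?M" "J \<in> ?M" and eq: "?f I = ?f J"
    have *: "nonbases E r H = (slice E r - undecided E r R) \<union> ?f H" if "H \<in> ?M" for H
      using nonbasis_if_decided[of E H _ r b] that
      by (auto simp: recorded_matroids_def) (auto simp: nonbases_def)
    have "nonbases E r I = nonbases E r J" using *[OF IJ(1)] *[OF IJ(2)] eq by simp
    then show "I = J" using IJ by (intro matroid_eq_of_nonbases[of E I r J]) (auto simp: recorded_matroids_def)
  qed
  then have "card ?M = card (?f ` ?M)" by (simp add: card_image)
  also have "?f ` ?M = traces (nonbases E r ` ?M) (undecided E r R)"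
    by (auto simp: traces_def image_image)
  finally show ?thesis by simp
qed

text \<open>
  An undecided nonbasis \<open>X\<close> either has only nonbases as neighbours, or it contains a circuit too
  large to be recorded and spans a hyperplane too small to be recorded. In the latter case the
  circuit misses at most \<open>2 b\<close> elements of \<open>X\<close> and the hyperplane has at most \<open>2 b\<close> elements
  outside \<open>X\<close>, so two sets of size at most \<open>2 b\<close> describe the nonbases around \<open>X\<close>.
\<close>
lemma card_local_traces_le:
  assumes E: "finite E" and X: "X \<in> undecided E r R"
    and r: "card E < 2 * r + 2 * b" "2 * r < card E + 2 * b" and n: "card E \<ge> 1"
  shows "card (traces {K \<in> nonbases E r ` recorded_matroids E b r R. X \<in> K} (johnson_nbrs E X))
    \<le> (card E + 1) ^ (4 * b + 1)"
proof -
  define f where "f = (\<lambda>(x, y). insert y (X - {x}))"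
  define g where "g = (\<lambda>(P, F). f ` {(x, y). x \<in> X \<and> y \<in> E - X \<and> (x \<in> P \<or> y \<in> F)})"
  define S where "S = {W. W \<subseteq> E \<and> card W \<le> 2 * b}"
  let ?T = "traces {K \<in> nonbases E r ` recorded_matroids E b r R. X \<in> K} (johnson_nbrs E X)"
  have XE: "X \<subseteq> E" "card X = r" and finX: "finite X"
    using X finite_subset[OF _ E] by (auto simp: undecided_def slice_def)
  have nbrs: "johnson_nbrs E X = f ` (X \<times> (E - X))"
    unfolding f_def by (rule johnson_nbrs_eq_exchanges[OF E XE(1)])
  \<comment> \<open>\<open>P\<close> is the part of \<open>X\<close> outside its circuit and \<open>F\<close> the part of the hyperplane outside \<open>X\<close>;
    \<open>g\<close> recovers the nonbases around \<open>X\<close> from them.\<close>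
  have "?T \<subseteq> insert (johnson_nbrs E X) (g ` (S \<times> S))"
  proof
    fix T assume "T \<in> ?T"
    then obtain I where I: "matroid E I" "matroid_rank I = r" "far_record E b r I = R"
      and XI: "X \<in> nonbases E r I" and T: "T = nonbases E r I \<inter> johnson_nbrs E X"
      by (auto simp: traces_def recorded_matroids_def)
    define C where "C = {x\<in>X. X - {x} \<in> I}"
    define P where "P = {x\<in>X. X - {x} \<notin> I}"
    define F where "F = {y\<in>E - X. \<not> spanning r I (insert y X)}"
    have "T = f ` {p \<in> X \<times> (E - X). f p \<in> nonbases E r I}"
      unfolding T nbrs by blast
    also have "{p \<in> X \<times> (E - X). f p \<in> nonbases E r I}
        = {(x, y). x \<in> X \<and> y \<in> E - X \<and> (x \<in> P \<or> y \<in> F)}"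
      using exchange_nonbasis_iff[OF I(1,2) XI] by (auto simp: f_def P_def F_def)
    finally have Tg: "T = g (P, F)" by (simp add: g_def)
    show "T \<in> insert (johnson_nbrs E X) (g ` (S \<times> S))"
    proof (cases "C = {}")
      case True
      then have "P = X" by (auto simp: C_def P_def)
      then have "T = johnson_nbrs E X" unfolding Tg nbrs g_def by auto
      then show ?thesis by simp
    next
      case False
      have "C \<subseteq> X" "P = X - C" by (auto simp: C_def P_def)
      then have cP: "card P = r - card C" "card C \<le> r"
        using finX XE card_mono by (auto simp: card_Diff_subset finite_subset)
      have "C \<notin> small_sets E b"
      proof
        assume "C \<in> small_sets E b"
        then have "C \<in> fst R"
          using circuit_of_nonbasis[OF I(1,2) XI] False I(3) unfolding C_def
          by (auto simp: far_record_def)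
        then show False using X \<open>C \<subseteq> X\<close> by (auto simp: undecided_def)
      qed
      then have "card E < 2 * card C + 2 * b"
        using \<open>C \<subseteq> X\<close> XE by (auto simp: small_sets_def)
      then have "card P \<le> 2 * b" using cP r by linarith
      then have P: "P \<in> S" using XE by (auto simp: S_def P_def)
      have "F \<subseteq> E" "X \<inter> F = {}" by (auto simp: F_def)
      have "X \<union> F \<notin> large_sets E b"
      proof
        assume "X \<union> F \<in> large_sets E b"
        then have "X \<union> F \<in> snd R"
          using hyperplane_of_nonbasis[OF I(1,2) XI] False I(3) unfolding C_def F_def
          by (auto simp: far_record_def)
        then show False using X by (auto simp: undecided_def)
      qed
      then have "2 * card (X \<union> F) < card E + 2 * b"
        using \<open>F \<subseteq> E\<close> XE by (auto simp: large_sets_def)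
      moreover have "card (X \<union> F) = r + card F"
        using \<open>F \<subseteq> E\<close> \<open>X \<inter> F = {}\<close> E XE finX finite_subset by (metis card_Un_disjoint)
      ultimately have "card F \<le> 2 * b" using r by linarith
      then have "F \<in> S" using \<open>F \<subseteq> E\<close> by (auto simp: S_def)
      then show ?thesis using P Tg by blast
    qed
  qed
  moreover have finS: "finite S" unfolding S_def by (rule finite_subset[of _ "Pow E"]) (use E in auto)
  ultimately have "card ?T \<le> card (insert (johnson_nbrs E X) (g ` (S \<times> S)))"
    by (intro card_mono) auto
  also have "\<dots> \<le> Suc (card (g ` (S \<times> S)))" by (rule card_insert_le_m1) simp_all
  also have "card (g ` (S \<times> S)) \<le> card S * card S"
    using finS card_image_le[of "S \<times> S" g] by (simp add: card_cartesian_product)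
  also have "\<dots> \<le> (card E + 1) ^ (2 * b) * (card E + 1) ^ (2 * b)"
    using card_small_subsets_le[OF E, of "2 * b"] unfolding S_def by (intro mult_mono) auto
  also have "\<dots> = (card E + 1) ^ (4 * b)" by (simp flip: power_add)
  also have "Suc ((card E + 1) ^ (4 * b)) \<le> 2 * (card E + 1) ^ (4 * b)" by simp
  also have "\<dots> \<le> (card E + 1) * (card E + 1) ^ (4 * b)" using n by (intro mult_right_mono) auto
  finally show ?thesis by simp
qed

text \<open>
  The branching bound applied to the nonbases within the undecided sets, with \<open>L = (n + 1) ^ (4
  b + 1)\<close>, \<open>D = r m\<close> and \<open>t = N / m\<close> from the supersaturation of the Johnson graph, and \<open>u = N /
  n\<^sup>2\<close>. The summand 3 in \<open>k\<close> makes \<open>L exp (- k) = (n + 1) powr (-2)\<close>, which is small enough as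
  \<open>D \<le> n\<^sup>2\<close>. The main term of the exponent is \<open>N / m\<close>, an upper bound for the size of a stable
  set.
\<close>
lemma card_recorded_matroids_le_powr:
  fixes E :: "'a set" and b r :: nat
  defines "n \<equiv> card E"
  defines "N \<equiv> real (n choose r)" and "m \<equiv> real (n - r + 1)"
  defines "k \<equiv> (4 * real b + 3) * ln (real n + 1)"
  assumes E: "finite E" and r: "1 \<le> r" "r \<le> n" "n < 2 * r + 2 * b" "2 * r < n + 2 * b"
    and n: "1 \<le> ln (real n + 1)" and kD: "k \<le> real r * m" and N: "4 * (real n)\<^sup>2 \<le> N"
  shows "real (card (recorded_matroids E b r R))
    \<le> 2 powr (N / m + N / (real n)\<^sup>2 + N * k / (real r * m) * log 2 (2 * (real n)\<^sup>2))"
proof -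
  define D where "D = real r * m"
  define u where "u = N / (real n)\<^sup>2"
  let ?A = "undecided E r R" and ?K = "nonbases E r ` recorded_matroids E b r R"
  have n1: "n \<ge> 1" using r by simp
  have m: "1 \<le> m" "m \<le> real n" using r by (auto simp: m_def)
  have N0: "N > 0" using r by (simp add: N_def)
  have D: "D > 0" "D \<le> (real n)\<^sup>2"
    using m r unfolding D_def power2_eq_square by (auto intro!: mult_mono)
  have A: "?A \<subseteq> slice E r" by (auto simp: undecided_def)
  have "card ?A \<le> card (slice E r)" by (intro card_mono A finite_slice E)
  then have cA: "real (card ?A) \<le> N" using card_slice[OF E] by (simp add: N_def n_def)
  have k2: "k \<ge> 2"
  proof -
    have "2 * 1 \<le> k" unfolding k_def using n by (intro mult_mono) auto
    then show ?thesis by simp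
  qed
  have u: "u \<ge> 4" "u / 2 > 0" "u / 2 \<le> N"
  proof -
    show "u \<ge> 4" using N n1 by (simp add: u_def field_simps)
    then show "u / 2 > 0" by simp
    have "1 \<le> (real n)\<^sup>2" using n1 by simp
    then have "u \<le> N / 1" unfolding u_def using N0 n1 by (intro divide_left_mono) auto
    then show "u / 2 \<le> N" using N0 by simp
  qed
  have "real (card (recorded_matroids E b r R)) \<le> real (card (traces ?K ?A))"
    using card_recorded_matroids_le[OF E] by (simp only: of_nat_le_iff)
  also have "\<dots> \<le> 2 powr (N / m + u) * (max (real (card ?A) - N / m) (u / 2) / (u / 2)) powr (N * k / D)"
  proof (rule card_traces_le[where nbr = "johnson_nbrs E" and V = ?A and L = "(n + 1) ^ (4 * b + 1)"])
    show "finite ?A" using A finite_slice[OF E] finite_subset by blast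
    show "real (card ?A) \<le> N" by (rule cA)
    fix v assume v: "v \<in> ?A"
    show "finite (johnson_nbrs E v) \<and> v \<notin> johnson_nbrs E v \<and>
        card (traces {K \<in> ?K. v \<in> K} (johnson_nbrs E v)) \<le> (n + 1) ^ (4 * b + 1)"
      using card_local_traces_le[OF E v] r n1 finite_johnson_nbrs[OF E] johnson_nbrs_irrefl
      unfolding n_def by blast
  next
    fix A assume "A \<subseteq> ?A" "A \<noteq> {}"
    then show "\<exists>v\<in>A. D / N * (real (card A) - N / m) \<le> real (card (johnson_nbrs E v \<inter> A))"
      using johnson_supersaturation[OF E r(1)] r A unfolding D_def N_def m_def n_def by blast
  next
    show "2 * D \<le> N" using D N by simp
    show "real ((n + 1) ^ (4 * b + 1)) * exp (- k) \<le> k / (2 * D)"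
    proof -
      have "exp k = (real n + 1) powr (real (4 * b + 3))"
        unfolding k_def powr_def by simp
      also have "\<dots> = (real n + 1) ^ (4 * b + 3)" by (rule powr_realpow) simp
      finally have ek: "exp k = (real n + 1) ^ (4 * b + 1) * (real n + 1)\<^sup>2"
        by (simp add: power_add power3_eq_cube power2_eq_square)
      have L: "real ((n + 1) ^ (4 * b + 1)) = (real n + 1) ^ (4 * b + 1)"
        by (simp only: of_nat_power of_nat_add of_nat_1)
      have cancel: "p * inverse (p * q) = 1 / q" if "p \<noteq> 0" for p q :: real
        using that by (simp add: divide_simps)
      have "real ((n + 1) ^ (4 * b + 1)) * exp (- k) = 1 / (real n + 1)\<^sup>2"
        unfolding exp_minus ek L by (rule cancel) simp
      also have "\<dots> \<le> 1 / D"
      proof -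
        have "D \<le> (real n + 1)\<^sup>2" using D by (smt (verit) of_nat_0_le_iff power_mono)
        then show ?thesis using D by (intro divide_left_mono) auto
      qed
      also have "\<dots> \<le> k / (2 * D)" using k2 D by (simp add: field_simps)
      finally show ?thesis .
    qed
    show "k \<le> D" using kD by (simp add: D_def)
  qed (use D k2 N0 m u in auto)
  also have "\<dots> \<le> 2 powr (N / m + u) * (2 * (real n)\<^sup>2) powr (N * k / D)"
  proof (intro mult_left_mono powr_mono2)
    have "max (real (card ?A) - N / m) (u / 2) \<le> N"
    proof -
      have "0 \<le> N / m" using N0 m by simp
      then show ?thesis using cA u(3) by linarith
    qed
    then have "max (real (card ?A) - N / m) (u / 2) / (u / 2) \<le> N / (u / 2)"
      using u by (intro divide_right_mono) auto
    also have "\<dots> = 2 * (real n)\<^sup>2" using N0 n1 by (simp add: u_def)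
    finally show "max (real (card ?A) - N / m) (u / 2) / (u / 2) \<le> 2 * (real n)\<^sup>2" .
  qed (use D k2 N0 u in auto)
  also have "(2 * (real n)\<^sup>2) powr (N * k / D) = 2 powr (N * k / D * log 2 (2 * (real n)\<^sup>2))"
  proof -
    have "2 powr (N * k / D * log 2 (2 * (real n)\<^sup>2)) = (2 powr log 2 (2 * (real n)\<^sup>2)) powr (N * k / D)"
      by (simp only: powr_powr mult.commute)
    also have "2 powr log 2 (2 * (real n)\<^sup>2) = 2 * (real n)\<^sup>2" using n1 by simp
    finally show ?thesis by simp
  qed
  finally show ?thesis by (simp add: powr_add u_def D_def)
qed

lemma card_rank_matroids_le:
  fixes E :: "'a set" and B :: real
  assumes E: "finite E" and rec: "\<And>R. real (card (recorded_matroids E b r R)) \<le> B"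
  shows "real (card {I. matroid E I \<and> matroid_rank I = r})
    \<le> 2 ^ (card (small_sets E b) + card (large_sets E b)) * B"
proof -
  let ?Rs = "Pow (small_sets E b) \<times> Pow (large_sets E b)"
  have fin: "finite (small_sets E b)" "finite (large_sets E b)"
    unfolding small_sets_def large_sets_def by (rule finite_subset[of _ "Pow E"]; use E in auto)+
  have "{I. matroid E I \<and> matroid_rank I = r} \<subseteq> (\<Union>R\<in>?Rs. recorded_matroids E b r R)"
  proof
    fix I assume "I \<in> {I. matroid E I \<and> matroid_rank I = r}"
    then have "I \<in> recorded_matroids E b r (far_record E b r I)" by (simp add: recorded_matroids_def)
    moreover have "far_record E b r I \<in> ?Rs" by (auto simp: far_record_def)
    ultimately show "I \<in> (\<Union>R\<in>?Rs. recorded_matroids E b r R)" by (rule UN_I[rotated])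
  qed
  moreover have "finite (recorded_matroids E b r R)" for R
    unfolding recorded_matroids_def by (rule finite_matroids[OF E])
  ultimately have "card {I. matroid E I \<and> matroid_rank I = r} \<le> card (\<Union>R\<in>?Rs. recorded_matroids E b r R)"
    using fin by (intro card_mono) auto
  also have "\<dots> \<le> (\<Sum>R\<in>?Rs. card (recorded_matroids E b r R))"
    using fin by (intro card_UN_le) auto
  finally have "real (card {I. matroid E I \<and> matroid_rank I = r})
      \<le> real (\<Sum>R\<in>?Rs. card (recorded_matroids E b r R))"
    by (simp only: of_nat_le_iff)
  also have "\<dots> = (\<Sum>R\<in>?Rs. real (card (recorded_matroids E b r R)))" by (rule of_nat_sum)
  also have "\<dots> \<le> (\<Sum>R\<in>?Rs. B)" by (intro sum_mono rec)
  also have "\<dots> = 2 ^ (card (small_sets E b) + card (large_sets E b)) * B"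
    using fin by (simp add: card_cartesian_product card_Pow power_add)
  finally show ?thesis .
qed

lemma card_rank_matroids_le_trivial:
  assumes E: "finite E"
  shows "card {I. matroid E I \<and> matroid_rank I = r} \<le> 2 ^ (card E choose r)"
proof -
  have "inj_on (nonbases E r) {I. matroid E I \<and> matroid_rank I = r}"
    by (rule inj_onI) (use matroid_eq_of_nonbases in blast)
  moreover have "nonbases E r ` {I. matroid E I \<and> matroid_rank I = r} \<subseteq> Pow (slice E r)"
    by (auto simp: nonbases_def)
  ultimately have "card {I. matroid E I \<and> matroid_rank I = r} \<le> card (Pow (slice E r))"
    using finite_slice[OF E] by (intro card_inj_on_le) auto
  then show ?thesis using finite_slice[OF E] card_slice[OF E] by (simp add: card_Pow)
qed

section \<open>Sparse paving matroids from stable families\<close>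

text \<open>
  Stable sets of the Johnson graph: distinct members share fewer than \<open>r - 1\<close> elements.
\<close>
definition stable_family :: "'a set \<Rightarrow> nat \<Rightarrow> 'a set set \<Rightarrow> bool" where
  "stable_family E r S \<longleftrightarrow> S \<subseteq> slice E r \<and> (\<forall>X\<in>S. \<forall>Y\<in>S. Y \<notin> johnson_nbrs E X)"

definition stable_matroid :: "'a set \<Rightarrow> nat \<Rightarrow> 'a set set \<Rightarrow> 'a set set" where
  "stable_matroid E r S = {X. X \<subseteq> E \<and> card X \<le> r \<and> X \<notin> S}"

lemma stable_family_subset: "stable_family E r S \<Longrightarrow> T \<subseteq> S \<Longrightarrow> stable_family E r T"
  unfolding stable_family_def by blast

text \<open>
  Two sets that extend \<open>T\<close> by one element each are adjacent. So at most one of the one-element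
  extensions of \<open>T\<close> is forbidden, on which both the augmentation axiom and the supply of bases
  rest.
\<close>
lemma stable_family_one_extension:
  assumes S: "stable_family E r S" and T: "finite T" "y \<notin> T" "z \<notin> T" "y \<noteq> z"
    and "insert y T \<in> S"
  shows "insert z T \<notin> S"
proof
  assume "insert z T \<in> S"
  moreover have "insert y T \<inter> insert z T = T" using T by auto
  ultimately have "insert z T \<in> johnson_nbrs E (insert y T)"
    using T S by (auto simp: johnson_nbrs_def stable_family_def slice_def)
  then show False using S assms(6) \<open>insert z T \<in> S\<close> by (auto simp: stable_family_def)
qed

lemma basis_below:
  assumes E: "finite E" and S: "stable_family E r S" and r: "1 \<le> r" and W: "W \<subseteq> E" "r < card W"
  shows "\<exists>B\<subseteq>W. card B = r \<and> B \<notin> S"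
proof -
  obtain U where U: "U \<subseteq> W" "card U = Suc r" using W(2) obtain_subset_with_card_n
    by (metis Suc_leI)
  have finU: "finite U" using U card_gt_0_iff by fastforce
  have "r - 1 \<le> card U" using U by simp
  then obtain T where T: "T \<subseteq> U" "card T = r - 1" by (rule obtain_subset_with_card_n)
  have finT: "finite T" using T finU finite_subset by blast
  have "card (U - T) = 2" using T U finT r by (simp add: card_Diff_subset)
  then obtain y z where yz: "U - T = {y, z}" "y \<noteq> z" by (meson card_2_iff)
  then have "insert y T \<notin> S \<or> insert z T \<notin> S"
    using stable_family_one_extension[OF S finT, of y z] by blast
  moreover have "y \<notin> T" "z \<notin> T" "y \<in> U" "z \<in> U" using yz by auto
  then have "card (insert y T) = r" "card (insert z T) = r" "insert y T \<subseteq> W" "insert z T \<subseteq> W"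
    using T finT U r by auto
  ultimately show ?thesis by blast
qed

text \<open>
  Augmentation can only fail when every \<open>insert y X\<close> with \<open>y \<in> Y - X\<close> belongs to \<open>S\<close>. There is
  then just one such \<open>y\<close>, and \<open>insert y X = Y\<close>, which is independent.
\<close>
lemma matroid_stable_matroid:
  assumes E: "finite E" and S: "stable_family E r S" and r: "1 \<le> r"
  shows "matroid E (stable_matroid E r S)"
  unfolding matroid_def
proof (intro conjI ballI allI impI)
  have size: "card X = r" if "X \<in> S" for X using S that by (auto simp: stable_family_def slice_def)
  show "finite E" by (rule E)
  show "stable_matroid E r S \<subseteq> Pow E" by (auto simp: stable_matroid_def)
  show "{} \<in> stable_matroid E r S" using size[of "{}"] r by (auto simp: stable_matroid_def)
  fix X Y assume X: "X \<in> stable_matroid E r S"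
  then have finX: "finite X" "X \<subseteq> E" "card X \<le> r" "X \<notin> S"
    using finite_subset[OF _ E] by (auto simp: stable_matroid_def)
  show "Y \<in> stable_matroid E r S" if "Y \<subseteq> X"
  proof (cases "Y = X")
    case False
    then have "card Y < card X" using that finX by (simp add: psubset_card_mono psubsetI)
    then show ?thesis using that finX size[of Y] by (auto simp: stable_matroid_def)
  qed (use X in simp)
  assume Y: "Y \<in> stable_matroid E r S" and less: "card X < card Y"
  have finY: "finite Y" "Y \<subseteq> E" "card Y \<le> r" "Y \<notin> S"
    using Y finite_subset[OF _ E] by (auto simp: stable_matroid_def)
  have ne: "Y - X \<noteq> {}" using less finX card_mono[of X Y] by auto
  show "\<exists>y\<in>Y - X. insert y X \<in> stable_matroid E r S"
  proof (cases "\<exists>y\<in>Y - X. insert y X \<notin> S")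
    case True
    then obtain y where "y \<in> Y - X" "insert y X \<notin> S" by blast
    then show ?thesis using finX finY less by (intro bexI[of _ y]) (auto simp: stable_matroid_def)
  next
    case False
    obtain y where y: "y \<in> Y - X" using ne by blast
    have "Y - X = {y}"
      using False stable_family_one_extension[OF S finX(1), of y] y by auto
    moreover have "card X = r - 1" using size[of "insert y X"] False y finX by auto
    then have "card Y = Suc (card X)" using less finY by simp
    ultimately have "X \<subseteq> Y"
    proof -
      have "card (Y \<inter> X) = card Y - card (Y - X)"
        using finY by (metis Diff_Diff_Int Diff_subset card_Diff_subset finite_Diff)
      also have "\<dots> = card X" using \<open>Y - X = {y}\<close> \<open>card Y = Suc (card X)\<close> by simp
      finally have "Y \<inter> X = X" using finX card_subset_eq by (metis inf_le2)
      then show ?thesis by blast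
    qed
    then have "insert y X = Y" using \<open>Y - X = {y}\<close> by blast
    then show ?thesis using y Y by auto
  qed
qed

lemma stable_matroid_rank_le:
  assumes "matroid E (stable_matroid E r S)"
  shows "matroid_rank (stable_matroid E r S) \<le> r"
  using matroid_rank_attained[OF assms] by (auto simp: stable_matroid_def)

lemma paving_stable_matroid:
  assumes E: "finite E" and S: "stable_family E r S" and r: "1 \<le> r"
  shows "paving E (stable_matroid E r S)"
  unfolding paving_def
proof
  fix C assume "C \<in> circuits E (stable_matroid E r S)"
  then have "C \<subseteq> E" "C \<notin> stable_matroid E r S" by (auto simp: circuits_def)
  then have "r \<le> card C" using S by (auto simp: stable_matroid_def stable_family_def slice_def)
  then show "matroid_rank (stable_matroid E r S) \<le> card C"
    using stable_matroid_rank_le[OF matroid_stable_matroid[OF assms]] by simp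
qed

text \<open>
  The complement of a set of fewer than \<open>card E - r\<close> elements has more than \<open>r\<close> elements and
  therefore contains a basis. So the dual has no dependent set that small, and its rank is at
  most \<open>card E - r\<close>.
\<close>
lemma sparse_stable_matroid:
  assumes E: "finite E" and S: "stable_family E r S" and r: "1 \<le> r" "r < card E"
  shows "sparse E (stable_matroid E r S)"
  unfolding sparse_def paving_def
proof
  let ?I = "stable_matroid E r S"
  note M = matroid_stable_matroid[OF E S r(1)]
  obtain B0 where B0: "B0 \<in> ?I" "card B0 = r"
    using basis_below[OF E S r(1) order.refl r(2)] by (auto simp: stable_matroid_def)
  have base: "card B = r" if B: "B \<in> bases ?I" for B
  proof (rule ccontr)
    assume "card B \<noteq> r"
    then have "card B < card B0" using that B0 by (auto simp: bases_def stable_matroid_def)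
    then obtain y where "y \<in> B0 - B" "insert y B \<in> ?I"
      using matroid_augment[OF M _ B0(1), of B] B by (auto simp: bases_def)
    then show False using that by (auto simp: bases_def)
  qed
  have dual_card: "card X \<le> card E - r" "finite X" if X: "X \<in> dual E ?I" for X
  proof -
    obtain B where B: "B \<in> bases ?I" "X \<subseteq> E - B" using X by (auto simp: dual_def)
    then have "B \<subseteq> E" "finite B" using finite_subset[OF _ E] by (auto simp: bases_def stable_matroid_def)
    then have "card (E - B) = card E - r" using base[OF B(1)] by (simp add: card_Diff_subset)
    then show "card X \<le> card E - r" "finite X"
      using B E card_mono[of "E - B" X] finite_subset[of X E] by auto
  qed
  have small: "X \<in> dual E ?I" if "X \<subseteq> E" "card X < card E - r" for X
  proof -
    have "card (E - X) = card E - card X" using that E finite_subset by (metis card_Diff_subset)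
    then have "r < card (E - X)" using that(2) by linarith
    then obtain B where B: "B \<subseteq> E - X" "card B = r" "B \<notin> S"
      using basis_below[OF E S r(1), of "E - X"] by blast
    then have "B \<in> ?I" by (auto simp: stable_matroid_def)
    moreover have "Z = B" if "Z \<in> ?I" "B \<subseteq> Z" for Z
      using that B card_seteq[of Z B] finite_subset[OF _ E, of Z] by (auto simp: stable_matroid_def)
    ultimately have "B \<in> bases ?I" by (auto simp: bases_def)
    then show ?thesis using B(1) that(1) by (auto simp: dual_def)
  qed
  fix C assume "C \<in> circuits E (dual E ?I)"
  then have "card E - r \<le> card C" using small[of C] by (force simp: circuits_def not_less)
  moreover have "matroid_rank (dual E ?I) \<le> card E - r"
  proof -
    have "dual E ?I \<subseteq> Pow E" by (auto simp: dual_def)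
    then have "finite (dual E ?I)" using E finite_subset by (metis finite_Pow_iff)
    moreover have "{} \<in> dual E ?I" using small[of "{}"] r by simp
    ultimately show ?thesis using dual_card unfolding matroid_rank_def by (subst Max_le_iff) auto
  qed
  ultimately show "matroid_rank (dual E ?I) \<le> card C" by simp
qed

text \<open>
  The construction of Graham and Sloane. Adjacent \<open>r\<close>-sets differ in one exchange \<open>x \<mapsto> y\<close> and
  their sums differ by \<open>y - x\<close>, which is not divisible by \<open>n\<close>. So the sets with a given sum
  modulo \<open>n\<close> are stable, and one of the \<open>n\<close> residues is at least as frequent as the average.
\<close>
lemma stable_family_by_sums:
  fixes n r :: nat
  assumes n: "n \<ge> 1"
  shows "\<exists>S. stable_family {1..n} r S \<and> n choose r \<le> n * card S"
proof -
  define Q where "Q c = {X \<in> slice {1..n} r. \<Sum>X mod n = c}" for c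
  have stable: "stable_family {1..n} r (Q c)" for c
    unfolding stable_family_def
  proof (intro conjI ballI notI)
    fix X Y assume X: "X \<in> Q c" and Y: "Y \<in> Q c" and XY: "Y \<in> johnson_nbrs {1..n} X"
    have XE: "X \<subseteq> {1..n}" "finite X" using X finite_subset by (auto simp: Q_def slice_def)
    obtain x y where xy: "x \<in> X" "y \<in> {1..n} - X" "Y = insert y (X - {x})"
      using XY johnson_nbrs_eq_exchanges[OF _ XE(1)] by auto
    have "\<Sum>Y + x = \<Sum>X + y" using xy XE sum.remove[of X x "\<lambda>i. i"] by simp
    moreover have "\<Sum>X mod n = \<Sum>Y mod n" using X Y by (simp add: Q_def)
    then have "(\<Sum>X + x) mod n = (\<Sum>Y + x) mod n" by (rule mod_add_cong) (rule refl)
    ultimately have "(\<Sum>X + x) mod n = (\<Sum>X + y) mod n" by simp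
    moreover have "x \<noteq> y" "1 \<le> x" "x \<le> n" "1 \<le> y" "y \<le> n" using xy XE by auto
    moreover have "\<not> n dvd (b - a)" if "a < b" "1 \<le> a" "b \<le> n" for a b
      using that by (auto dest!: dvd_imp_le)
    ultimately show False
      using mod_eq_dvd_iff_nat[of "\<Sum>X + x" "\<Sum>X + y" n] mod_eq_dvd_iff_nat[of "\<Sum>X + y" "\<Sum>X + x" n]
      by (cases x y rule: linorder_cases) auto
  qed (auto simp: Q_def)
  have "\<exists>c<n. n choose r \<le> n * card (Q c)"
  proof (rule ccontr)
    assume neg: "\<not> ?thesis"
    have "slice {1..n} r = (\<Union>c<n. Q c)" using n by (auto simp: Q_def)
    then have "n choose r \<le> (\<Sum>c<n. card (Q c))"
      using card_slice[of "{1..n}" r] card_UN_le[of "{..<n}" Q] by simp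
    then have "n * (n choose r) \<le> (\<Sum>c<n. n * card (Q c))"
      by (metis mult_le_mono2 sum_distrib_left)
    also have "\<dots> < (\<Sum>c<n. n choose r)"
      using neg n by (intro sum_strict_mono) (auto simp: not_le lessThan_empty_iff)
    finally show False by simp
  qed
  then show ?thesis using stable by blast
qed

text \<open>
  Every subfamily of a stable family is stable, and distinct subfamilies give distinct matroids.
\<close>
lemma num_sparse_paving_ge:
  fixes n r :: nat
  assumes r: "1 \<le> r" "r < n"
  shows "2 powr (real (n choose r) / real n) \<le> real (num_sparse_paving n)"
proof -
  obtain S where S: "stable_family {1..n} r S" "n choose r \<le> n * card S"
    using stable_family_by_sums[of n r] r by auto
  let ?P = "{I. matroid {1..n} I \<and> sparse_paving {1..n} I}"
  have SE: "S \<subseteq> slice {1..n} r" using S by (simp add: stable_family_def)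
  then have finS: "finite S" using finite_slice finite_subset by blast
  have "inj_on (stable_matroid {1..n} r) (Pow S)"
  proof
    fix T U assume "T \<in> Pow S" "U \<in> Pow S" and eq: "stable_matroid {1..n} r T = stable_matroid {1..n} r U"
    then have "T = slice {1..n} r - stable_matroid {1..n} r T" "U = slice {1..n} r - stable_matroid {1..n} r U"
      using SE by (auto simp: stable_matroid_def slice_def)
    then show "T = U" using eq by simp
  qed
  moreover have "stable_matroid {1..n} r ` Pow S \<subseteq> ?P"
  proof
    fix I assume "I \<in> stable_matroid {1..n} r ` Pow S"
    then obtain T where T: "T \<subseteq> S" and I: "I = stable_matroid {1..n} r T" by blast
    have "stable_family {1..n} r T" using S(1) T by (rule stable_family_subset)
    then show "I \<in> ?P"
      using matroid_stable_matroid[of "{1..n}" r T] paving_stable_matroid[of "{1..n}" r T]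
        sparse_stable_matroid[of "{1..n}" r T] r I by (simp add: sparse_paving_def)
  qed
  moreover have "finite ?P"
    by (rule finite_subset[of _ "Pow (Pow {1..n})"]) (auto simp: matroid_def)
  ultimately have "card (Pow S) \<le> num_sparse_paving n"
    unfolding num_sparse_paving_def by (intro card_inj_on_le)
  then have "2 ^ card S \<le> num_sparse_paving n" using finS by (simp add: card_Pow)
  then have "real (2 ^ card S) \<le> real (num_sparse_paving n)" by (simp only: of_nat_le_iff)
  moreover have "real (n choose r) \<le> real (card S) * real n"
    using S(2) by (metis mult.commute of_nat_le_iff of_nat_mult)
  then have "2 powr (real (n choose r) / real n) \<le> 2 powr (real (card S))"
    using r by (intro powr_mono) (auto simp: field_simps)
  moreover have "2 powr real (card S) = real (2 ^ card S)" by (simp add: powr_realpow)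
  ultimately show ?thesis by linarith
qed

section \<open>The number of far sets\<close>

lemma cosh_le_exp_square:
  fixes x :: real
  assumes "0 \<le> x" "x \<le> 1"
  shows "(exp x + exp (- x)) / 2 \<le> exp (x\<^sup>2)"
proof -
  have "exp x \<le> 1 + x + x\<^sup>2" using assms by (rule exp_bound)
  moreover have "exp (- x) \<le> 1 - x + x\<^sup>2"
  proof -
    have "1 \<le> (1 - x + x\<^sup>2) * (1 + x)"
      using assms by (simp add: algebra_simps power2_eq_square)
    also have "\<dots> \<le> (1 - x + x\<^sup>2) * exp x"
      using assms exp_ge_add_one_self[of x] by (intro mult_left_mono) auto
    finally show ?thesis by (simp add: exp_minus field_simps)
  qed
  ultimately have "(exp x + exp (- x)) / 2 \<le> 1 + x\<^sup>2" by simp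
  also have "\<dots> \<le> exp (x\<^sup>2)" by (rule exp_ge_add_one_self)
  finally show ?thesis .
qed

lemma binomial_theorem_subsets:
  fixes a c :: real
  assumes "finite E"
  shows "(\<Sum>W\<in>Pow E. a ^ card W * c ^ card (E - W)) = (a + c) ^ card E"
  using prod_add[OF assms, of "\<lambda>_. a" "\<lambda>_. c"] by simp

text \<open>
  Chernoff bound: weight a set \<open>W\<close> by \<open>exp (s (card W - card (E - W)))\<close>. The total weight is
  \<open>(exp s + exp (- s)) ^ n \<le> 2 ^ n * exp (n * s\<^sup>2)\<close>, every large set has weight at least \<open>exp (2
  * b * s)\<close>, and \<open>s = b / n\<close> balances the two.
\<close>
lemma card_large_sets_le:
  assumes E: "finite E" and b: "0 < b" "b \<le> card E"
  shows "real (card (large_sets E b)) \<le> 2 ^ card E * exp (- (real b)\<^sup>2 / real (card E))"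
proof -
  define n where "n = card E"
  define s where "s = real b / real n"
  have s: "0 \<le> s" "s \<le> 1" and n: "real n > 0" using b by (auto simp: s_def n_def)
  have fin: "finite (large_sets E b)"
    unfolding large_sets_def by (rule finite_subset[of _ "Pow E"]) (use E in auto)
  have "real (card (large_sets E b)) * exp (2 * real b * s) = (\<Sum>W\<in>large_sets E b. exp (2 * real b * s))"
    by simp
  also have "\<dots> \<le> (\<Sum>W\<in>large_sets E b. exp s ^ card W * exp (- s) ^ card (E - W))"
  proof (rule sum_mono)
    fix W assume W: "W \<in> large_sets E b"
    then have "W \<subseteq> E" by (simp add: large_sets_def)
    then have "card (E - W) = n - card W" "card W \<le> n"
      using E finite_subset[of W E] card_mono[of E W] by (auto simp: n_def card_Diff_subset)
    then have "real (card W) - real (card (E - W)) \<ge> 2 * real b"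
      using W by (auto simp: large_sets_def n_def of_nat_diff)
    then have "2 * real b * s \<le> (real (card W) - real (card (E - W))) * s"
      using s by (intro mult_right_mono) auto
    also have "\<dots> = real (card W) * s + real (card (E - W)) * (- s)" by (simp add: algebra_simps)
    finally have "exp (2 * real b * s) \<le> exp (real (card W) * s + real (card (E - W)) * (- s))" by simp
    then show "exp (2 * real b * s) \<le> exp s ^ card W * exp (- s) ^ card (E - W)"
      by (simp only: exp_add exp_of_nat_mult)
  qed
  also have "\<dots> \<le> (\<Sum>W\<in>Pow E. exp s ^ card W * exp (- s) ^ card (E - W))"
    using E by (intro sum_mono2) (auto simp: large_sets_def)
  also have "\<dots> = (exp s + exp (- s)) ^ n" using binomial_theorem_subsets[OF E] by (simp add: n_def)
  also have "\<dots> \<le> (2 * exp (s\<^sup>2)) ^ n"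
    using cosh_le_exp_square[OF s] by (intro power_mono) (auto simp: add_nonneg_nonneg)
  also have "\<dots> = 2 ^ n * exp (real n * s\<^sup>2)" by (simp add: power_mult_distrib exp_of_nat_mult)
  finally have "real (card (large_sets E b)) \<le> 2 ^ n * exp (real n * s\<^sup>2) / exp (2 * real b * s)"
    by (simp add: pos_le_divide_eq)
  also have "\<dots> = 2 ^ n * exp (real n * s\<^sup>2 - 2 * real b * s)" by (simp add: exp_diff)
  also have "real n * s\<^sup>2 - 2 * real b * s = - (real b)\<^sup>2 / real n"
    using n by (simp add: s_def power2_eq_square)
  finally show ?thesis by (simp add: n_def)
qed

lemma card_small_sets:
  assumes E: "finite E"
  shows "card (small_sets E b) = card (large_sets E b)"
proof -
  have co: "card (E - W) + card W = card E" if "W \<subseteq> E" for W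
    using that E finite_subset[of W E] card_mono[of E W] by (simp add: card_Diff_subset)
  have "bij_betw (\<lambda>W. E - W) (small_sets E b) (large_sets E b)"
  proof (rule bij_betwI[where g = "\<lambda>W. E - W"])
    show "(\<lambda>W. E - W) \<in> small_sets E b \<rightarrow> large_sets E b"
    proof (rule Pi_I)
      fix W assume "W \<in> small_sets E b"
      then have "W \<subseteq> E" "2 * card W + 2 * b \<le> card E" by (auto simp: small_sets_def)
      then have "card E + 2 * b \<le> 2 * card (E - W)" using co[of W] by linarith
      then show "E - W \<in> large_sets E b" by (simp add: large_sets_def)
    qed
    show "(\<lambda>W. E - W) \<in> large_sets E b \<rightarrow> small_sets E b"
    proof (rule Pi_I)
      fix W assume "W \<in> large_sets E b"
      then have "W \<subseteq> E" "card E + 2 * b \<le> 2 * card W" by (auto simp: large_sets_def)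
      then have "2 * card (E - W) + 2 * b \<le> card E" using co[of W] by linarith
      then show "E - W \<in> small_sets E b" by (simp add: small_sets_def)
    qed
  qed (auto simp: small_sets_def large_sets_def)
  then show ?thesis by (rule bij_betw_same_card)
qed

lemma two_power_le_central_binomial: "2 ^ n \<le> (n + 1) * (n choose (n div 2))"
proof -
  have "2 ^ n = (\<Sum>k\<le>n. n choose k)" by (simp add: choose_row_sum)
  also have "\<dots> \<le> (\<Sum>k\<le>n. n choose (n div 2))" by (intro sum_mono binomial_maximum)
  finally show ?thesis by simp
qed

section \<open>Asymptotics\<close>

text \<open>
  With margin \<open>b = \<lceil>n powr (3/4)\<rceil>\<close>, \<open>half_margin n\<close> is a lower bound for both \<open>r\<close> and \<open>n - r +
  1\<close>, for the ranks \<open>r\<close> at which the branching bound is used.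
\<close>
definition half_margin :: "nat \<Rightarrow> real" where
  "half_margin n = real n / 2 - real n powr (3/4) - 1"

text \<open>
  A bound for the logarithm of the number of matroids of one rank, divided by the central
  binomial coefficient. The four terms come from the record of the far sets, the largest stable
  sets, the slack \<open>u = N / n\<^sup>2\<close>, and the cost of the branching. The exponent \<open>3/4\<close> of the margin
  leaves room on both sides: above \<open>1/2\<close> the first term is negligible, below \<open>1\<close> the last one
  is.
\<close>
definition rank_rate :: "nat \<Rightarrow> real" where
  "rank_rate n = 2 * (real n + 1) * exp (- sqrt (real n)) + 1 / half_margin n + 1 / (real n)\<^sup>2
     + (4 * real n powr (3/4) + 7) * ln (real n + 1) * log 2 (2 * (real n)\<^sup>2) / (half_margin n)\<^sup>2"

definition matroid_rate :: "nat \<Rightarrow> real" where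
  "matroid_rate n = log 2 (real n + 1) * (real n + 1) / 2 ^ n + rank_rate n"

lemma matroid_rate_asymp: "(\<lambda>n. real n * matroid_rate n) \<longlonglongrightarrow> 2"
  unfolding matroid_rate_def rank_rate_def half_margin_def by real_asymp

lemma card_far_sets_le:
  assumes E: "finite E" and b: "0 < b" "b \<le> card E" and sq: "sqrt (real (card E)) * real (card E) \<le> (real b)\<^sup>2"
  shows "real (card (small_sets E b) + card (large_sets E b))
    \<le> real (card E choose (card E div 2)) * (2 * (real (card E) + 1) * exp (- sqrt (real (card E))))"
proof -
  let ?n = "card E"
  have n: "real ?n > 0" using b by simp
  have "real (card (large_sets E b)) \<le> 2 ^ ?n * exp (- (real b)\<^sup>2 / real ?n)"
    by (rule card_large_sets_le[OF E b])
  also have "\<dots> \<le> 2 ^ ?n * exp (- sqrt (real ?n))"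
    using sq n by (simp add: field_simps)
  also have "\<dots> \<le> ((real ?n + 1) * real (?n choose (?n div 2))) * exp (- sqrt (real ?n))"
  proof (rule mult_right_mono)
    have "real (2 ^ ?n) \<le> real ((?n + 1) * (?n choose (?n div 2)))"
      using two_power_le_central_binomial[of ?n] by (simp only: of_nat_le_iff)
    then show "2 ^ ?n \<le> (real ?n + 1) * real (?n choose (?n div 2))"
      by (simp only: of_nat_mult of_nat_add of_nat_1 of_nat_power of_nat_numeral)
  qed simp
  finally show ?thesis by (simp add: card_small_sets[OF E] algebra_simps)
qed

text \<open>
  For ranks far from \<open>n / 2\<close> all \<open>r\<close>-sets are themselves far sets, so the trivial bound is
  enough. For the other ranks the branching bound applies, and \<open>r\<close>, \<open>n - r + 1\<close> are replaced by
  the lower bound \<open>half_margin n\<close>.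
\<close>
lemma card_rank_matroids_asymp:
  "\<forall>\<^sub>F n in sequentially. \<forall>r. real (card {I. matroid {1..n} I \<and> matroid_rank I = r})
     \<le> 2 powr (real (n choose (n div 2)) * rank_rate n)"
proof -
  have "\<forall>\<^sub>F n in sequentially. real n / 4 \<le> half_margin n"
    unfolding half_margin_def by real_asymp
  moreover have "\<forall>\<^sub>F n :: nat in sequentially. real n powr (3/4) + 1 \<le> real n / 4" by real_asymp
  moreover have "\<forall>\<^sub>F n :: nat in sequentially. 1 \<le> ln (real n + 1)" by real_asymp
  moreover have "\<forall>\<^sub>F n in sequentially. (4 * real n powr (3/4) + 7) * ln (real n + 1) \<le> (half_margin n)\<^sup>2"
    unfolding half_margin_def by real_asymp
  moreover have "\<forall>\<^sub>F n :: nat in sequentially. 4 * (real n)\<^sup>2 \<le> (4/3) powr (real n / 4)" by real_asymp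
  ultimately show ?thesis using eventually_gt_at_top[of "0::nat"]
  proof eventually_elim
    case (elim n)
    define h where "h = half_margin n"
    define x where "x = real n powr (3/4)"
    define b where "b = nat \<lceil>x\<rceil>"
    define C where "C = real (n choose (n div 2))"
    let ?E = "{1..n}"
    let ?far = "card (small_sets ?E b) + card (large_sets ?E b)"
    have n: "real n > 0" and h: "h \<ge> real n / 4" "h > 0" "h = real n / 2 - x - 1"
      using elim by (auto simp: h_def half_margin_def x_def)
    have x: "0 < x" "x + 1 \<le> real n / 4" using elim n by (auto simp: x_def)
    have b: "x \<le> real b" "real b \<le> x + 1" unfolding b_def using x by linarith+
    have b0: "0 < b" "b \<le> n" using b x n by linarith+
    have C0: "C \<ge> 0" by (simp add: C_def)
    have "1 \<le> (real n)\<^sup>2" using n by simp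
    then have "log 2 1 \<le> log 2 (2 * (real n)\<^sup>2)" by (intro log_mono) auto
    then have lg: "0 \<le> log 2 (2 * (real n)\<^sup>2)" by simp
    define K where "K = (4 * x + 7) * ln (real n + 1)"
    have K0: "0 \<le> K" using x elim by (auto simp: K_def intro!: mult_nonneg_nonneg)
    have rate: "rank_rate n = 2 * (real n + 1) * exp (- sqrt (real n)) + 1 / h + 1 / (real n)\<^sup>2
        + K * log 2 (2 * (real n)\<^sup>2) / h\<^sup>2"
      by (simp add: rank_rate_def K_def h_def x_def)
    have "sqrt (real n) * real n = x\<^sup>2"
    proof -
      have "x\<^sup>2 = real n powr (1/2 + 1)" unfolding x_def power2_eq_square by (simp flip: powr_add)
      then show ?thesis using n by (simp only: powr_add powr_one powr_half_sqrt)
    qed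
    also have "x\<^sup>2 \<le> (real b)\<^sup>2" using x b by (intro power_mono) auto
    finally have far: "real ?far \<le> C * (2 * (real n + 1) * exp (- sqrt (real n)))"
      using card_far_sets_le[of ?E b] b0 by (simp add: C_def)
    show ?case
    proof
      fix r
      let ?M = "{I. matroid ?E I \<and> matroid_rank I = r}"
      show "real (card ?M) \<le> 2 powr (real (n choose (n div 2)) * rank_rate n)"
      proof (cases "n < 2 * r + 2 * b \<and> 2 * r < n + 2 * b")
        case False
        have "slice ?E r \<subseteq> small_sets ?E b \<or> slice ?E r \<subseteq> large_sets ?E b"
          using False by (auto simp: slice_def small_sets_def large_sets_def)
        moreover have "finite (small_sets ?E b)" "finite (large_sets ?E b)"
          unfolding small_sets_def large_sets_def by (rule finite_subset[of _ "Pow ?E"]; auto)+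
        ultimately have "card (slice ?E r) \<le> card (small_sets ?E b) \<or> card (slice ?E r) \<le> card (large_sets ?E b)"
          using card_mono by blast
        then have "n choose r \<le> ?far" using card_slice[of ?E r] by auto
        then have "real (n choose r) \<le> C * (2 * (real n + 1) * exp (- sqrt (real n)))"
          using far by linarith
        also have "\<dots> \<le> C * rank_rate n"
          unfolding rate using C0 h K0 lg by (intro mult_left_mono) auto
        finally have e: "real (n choose r) \<le> C * rank_rate n" .
        have "real (card ?M) \<le> real (2 ^ (n choose r))"
          using card_rank_matroids_le_trivial[of ?E r] by (simp only: of_nat_le_iff finite_atLeastAtMost card_atLeastAtMost diff_Suc_1)
        also have "\<dots> = 2 powr (real (n choose r))" by (simp add: powr_realpow)
        also have "\<dots> \<le> 2 powr (C * rank_rate n)" using e by simp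
        finally show ?thesis by (simp only: C_def)
      next
        case True
        define m where "m = real (n - r + 1)"
        define k where "k = (4 * real b + 3) * ln (real n + 1)"
        define R where "R = real (n choose r)"
        have r: "h \<le> real r" "real r \<le> 3 / 4 * real n" "1 \<le> r" "r \<le> n" and m: "h \<le> m"
        proof -
          have "real n < 2 * real r + 2 * real b" "2 * real r < real n + 2 * real b"
            using True by linarith+
          then show "h \<le> real r" "real r \<le> 3 / 4 * real n" using b x h n by linarith+
          then show rn: "r \<le> n" "1 \<le> r" using h n by linarith+
          show "h \<le> m" unfolding m_def
            using \<open>2 * real r < real n + 2 * real b\<close> b h rn by (simp add: of_nat_diff)
        qed
        have R: "0 \<le> R" "R \<le> C" using binomial_maximum[of n r] by (simp_all add: R_def C_def)
        \<comment> \<open>As \<open>r \<le> 3 n / 4\<close>, this slice is exponentially large, as the branching bound requires.\<close>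
        have "(4/3) powr (real n / 4) \<le> (4/3) powr real r"
          using r h by (intro powr_mono) auto
        also have "\<dots> = (4/3) ^ r" by (simp add: powr_realpow)
        also have "\<dots> \<le> (real n / real r) ^ r"
          using r by (intro power_mono) (auto simp: field_simps)
        also have "\<dots> \<le> R" unfolding R_def using r by (intro binomial_ge_n_over_k_pow_k)
        finally have R4: "4 * (real n)\<^sup>2 \<le> R" using elim by linarith
        have k: "0 \<le> k" "k \<le> K" unfolding k_def K_def
          using b elim by (auto intro!: mult_right_mono mult_nonneg_nonneg)
        have hh: "h\<^sup>2 \<le> real r * m" unfolding power2_eq_square using h r m by (intro mult_mono) auto
        have kh: "k \<le> real r * m"
          using k hh elim unfolding K_def x_def h_def by linarith
        have "real (card ?M) \<le> 2 ^ ?far *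
            2 powr (R / m + R / (real n)\<^sup>2 + R * k / (real r * m) * log 2 (2 * (real n)\<^sup>2))"
        proof (rule card_rank_matroids_le)
          show "real (card (recorded_matroids ?E b r X))
            \<le> 2 powr (R / m + R / (real n)\<^sup>2 + R * k / (real r * m) * log 2 (2 * (real n)\<^sup>2))" for X
            using card_recorded_matroids_le_powr[of ?E r b X] True r elim kh R4
            by (simp add: R_def m_def k_def)
        qed simp
        also have "(2 :: real) ^ ?far = 2 powr real ?far" by (simp only: powr_realpow)
        also have "2 powr real ?far *
            2 powr (R / m + R / (real n)\<^sup>2 + R * k / (real r * m) * log 2 (2 * (real n)\<^sup>2))
          = 2 powr (real ?far +
              (R / m + R / (real n)\<^sup>2 + R * k / (real r * m) * log 2 (2 * (real n)\<^sup>2)))"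
          by (simp only: powr_add)
        also have "\<dots> \<le> 2 powr (C * rank_rate n)"
        proof (rule powr_mono)
          have "R / m \<le> C / h" using R h m by (intro frac_le) auto
          moreover have "R / (real n)\<^sup>2 \<le> C / (real n)\<^sup>2" using R by (intro divide_right_mono) auto
          moreover have "R * k / (real r * m) * log 2 (2 * (real n)\<^sup>2)
              \<le> C * K / h\<^sup>2 * log 2 (2 * (real n)\<^sup>2)"
            using R k hh h lg C0 by (intro mult_right_mono frac_le mult_mono) auto
          ultimately have "real ?far + (R / m + R / (real n)\<^sup>2 + R * k / (real r * m) * log 2 (2 * (real n)\<^sup>2))
            \<le> C * (2 * (real n + 1) * exp (- sqrt (real n)))
              + (C / h + C / (real n)\<^sup>2 + C * K / h\<^sup>2 * log 2 (2 * (real n)\<^sup>2))"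
            using far by linarith
          also have "\<dots> = C * rank_rate n" unfolding rate by (simp add: algebra_simps)
          finally show "real ?far + (R / m + R / (real n)\<^sup>2
              + R * k / (real r * m) * log 2 (2 * (real n)\<^sup>2)) \<le> C * rank_rate n" .
        qed simp
        finally show ?thesis by (simp only: C_def)
      qed
    qed
  qed
qed

lemma num_matroids_asymp:
  "\<forall>\<^sub>F n in sequentially.
     log 2 (real (num_matroids n)) \<le> real (n choose (n div 2)) * matroid_rate n"
  using card_rank_matroids_asymp eventually_gt_at_top[of "0::nat"]
proof eventually_elim
  case (elim n)
  define C where "C = real (n choose (n div 2))"
  let ?M = "\<lambda>r. {I. matroid {1..n} I \<and> matroid_rank I = r}"
  have "{I. matroid {1..n} I} \<subseteq> (\<Union>r\<le>n. ?M r)"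
  proof
    fix I :: "nat set set" assume "I \<in> {I. matroid {1..n} I}"
    then have M: "matroid {1..n} I" by simp
    obtain B where B: "B \<in> I" "card B = matroid_rank I" using matroid_rank_attained[OF M] by blast
    then have "B \<subseteq> {1..n}" using M by (auto simp: matroid_def)
    then have "matroid_rank I \<le> n" using B(2) card_mono[of "{1..n}" B] by simp
    then show "I \<in> (\<Union>r\<le>n. ?M r)" using M by simp
  qed
  then have "num_matroids n \<le> card (\<Union>r\<le>n. ?M r)"
    unfolding num_matroids_def using finite_matroids[of "{1..n}"] by (intro card_mono finite_UN_I) auto
  also have "\<dots> \<le> (\<Sum>r\<le>n. card (?M r))" by (intro card_UN_le) simp
  finally have "real (num_matroids n) \<le> real (\<Sum>r\<le>n. card (?M r))" by (simp only: of_nat_le_iff)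
  also have "\<dots> = (\<Sum>r\<le>n. real (card (?M r)))" by (rule of_nat_sum)
  also have "\<dots> \<le> (\<Sum>r\<le>n. 2 powr (C * rank_rate n))"
    using elim(1) unfolding C_def by (intro sum_mono) blast
  also have "\<dots> = 2 powr (log 2 (real n + 1) + C * rank_rate n)" by (simp add: powr_add add_ac)
  finally have le: "real (num_matroids n) \<le> 2 powr (log 2 (real n + 1) + C * rank_rate n)" .
  have "{{}} \<in> {I. matroid {1..n} I}" by (auto simp: matroid_def)
  then have "num_matroids n > 0"
    unfolding num_matroids_def using finite_matroids[of "{1..n}" "\<lambda>_. True"] by (auto simp: card_gt_0_iff)
  then have "log 2 (real (num_matroids n)) \<le> log 2 (real n + 1) + C * rank_rate n"
    using le by (simp add: log_le_iff)
  also have "log 2 (real n + 1) \<le> C * (log 2 (real n + 1) * (real n + 1) / 2 ^ n)"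
  proof -
    have "real (2 ^ n) \<le> real ((n + 1) * (n choose (n div 2)))"
      using two_power_le_central_binomial[of n] by (simp only: of_nat_le_iff)
    then have "1 \<le> C * (real n + 1) / 2 ^ n" by (simp add: C_def field_simps)
    then have "log 2 (real n + 1) * 1 \<le> log 2 (real n + 1) * (C * (real n + 1) / 2 ^ n)"
      by (intro mult_left_mono) auto
    then show ?thesis by (simp add: mult_ac)
  qed
  finally show ?case by (simp add: C_def matroid_rate_def distrib_left)
qed

theorem corollary4:
  "\<exists>e :: nat \<Rightarrow> real. e \<in> o(\<lambda>_. 1) \<and>
     (\<forall>\<^sub>F n in sequentially.
        log 2 (log 2 (real (num_matroids n)))
          \<le> log 2 (log 2 (real (num_sparse_paving n))) + 1 + e n)"
proof (intro exI conjI)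
  \<comment> \<open>The error is \<open>log 2 q - 1\<close>, where \<open>a\<close> bounds \<open>log 2 (num_sparse_paving n)\<close> from below,
    \<open>a * q\<close> bounds \<open>log 2 (num_matroids n)\<close> from above, and \<open>q\<close> tends to 2.\<close>
  let ?e = "\<lambda>n. log 2 (real n * matroid_rate n) - 1"
  have "?e \<longlonglongrightarrow> log 2 2 - 1"
    by (intro tendsto_intros matroid_rate_asymp) auto
  then show "?e \<in> o(\<lambda>_. 1)" by (intro smalloI_tendsto) auto
  show "\<forall>\<^sub>F n in sequentially. log 2 (log 2 (real (num_matroids n)))
      \<le> log 2 (log 2 (real (num_sparse_paving n))) + 1 + ?e n"
    using num_matroids_asymp eventually_gt_at_top[of "1::nat"]
  proof eventually_elim
    case (elim n)
    define a where "a = real (n choose (n div 2)) / real n"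
    have a: "a > 0" using elim(2) by (simp add: a_def)
    have s: "2 powr a \<le> real (num_sparse_paving n)"
      unfolding a_def using elim(2) by (intro num_sparse_paving_ge) auto
    then have sp: "real (num_sparse_paving n) > 0" by (smt (verit) powr_gt_zero)
    have "num_sparse_paving n \<le> num_matroids n"
      unfolding num_sparse_paving_def num_matroids_def
      using finite_matroids[of "{1..n}" "\<lambda>_. True"] by (intro card_mono) auto
    then have sm: "real (num_sparse_paving n) \<le> real (num_matroids n)" by simp
    have ls: "a \<le> log 2 (real (num_sparse_paving n))" using s sp by (simp add: le_log_iff)
    also have lsm: "\<dots> \<le> log 2 (real (num_matroids n))" using sp sm by simp
    finally have lm: "a \<le> log 2 (real (num_matroids n))" .
    have le: "log 2 (real (num_matroids n)) \<le> a * (real n * matroid_rate n)"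
      using elim by (simp add: a_def)
    then have q: "real n * matroid_rate n > 0"
      using a lm by (smt (verit) zero_less_mult_pos)
    have "log 2 (log 2 (real (num_matroids n))) \<le> log 2 (a * (real n * matroid_rate n))"
      using le lm a q by simp
    also have "\<dots> = log 2 a + log 2 (real n * matroid_rate n)" using a q by (intro log_mult_pos)
    also have "log 2 a \<le> log 2 (log 2 (real (num_sparse_paving n)))" using a ls by simp
    finally show ?case by simp
  qed
qed

end
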